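(* Let $L$ be a countable relational language and let $\mathcal{M}$ be a countable infinite $L$-structure. If $\mathcal{M}$ has trivial definable closure, then there is an invariant probability measure $\mu$ on $S_L$ that is concentrated on $\mathcal{M}$.
   Context: $S_L$ is the set of $L$-structures with underlying set $\mathbb{N}$, with the Borel $\sigma$-algebra generated by the sets $\{\mathcal{N}: R^{\mathcal{N}}(n_1,\dots,n_j)\}$. A measure on $S_L$ is invariant if it is invariant under the logic action of $\mathrm{Sym}(\mathbb{N})$ (induced by permuting the underlying set $\mathbb{N}$), and is concentrated on $\mathcal{M}$ if it assigns measure $1$ to the set of structures in $S_L$ isomorphic to $\mathcal{M}$. $\mathcal{M}$ has trivial definable closure if for every finite tuple $\mathbf{a}$ in $\mathcal{M}$, the only elements fixed by all automorphisms of $\mathcal{M}$ fixing $\mathbf{a}$ pointwise are the entries of $\mathbf{a}$. *)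

theory Defs
  imports "HOL-Probability.Probability"
begin

text \<open>
  A relational language is given by its set \<open>L\<close> of relation symbols together with an arity
  function \<open>ar\<close>. Tuples are lists, so that \<open>ns \<in> rel N R\<close> stands for
  \<open>R\<^sup>N(n\<^sub>1, \<dots>, n\<^sub>j)\<close>.
\<close>

record ('r, 'a) relstruct =
  universe :: "'a set"
  rel :: "'r \<Rightarrow> 'a list set"

text \<open>
  Symbols outside \<open>L\<close> are interpreted by the empty set, so that two \<open>L\<close>-structures
  with the same universe are equal as soon as they interpret the symbols of \<open>L\<close> in the same way.
\<close>

definition is_structure :: "'r set \<Rightarrow> ('r \<Rightarrow> nat) \<Rightarrow> ('r, 'a) relstruct \<Rightarrow> bool" where
  "is_structure L ar M \<longleftrightarrow>
     (\<forall>R\<in>L. rel M R \<subseteq> {xs. length xs = ar R \<and> set xs \<subseteq> universe M}) \<and>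
     (\<forall>R. R \<notin> L \<longrightarrow> rel M R = {})"

definition iso_between ::
  "'r set \<Rightarrow> ('r \<Rightarrow> nat) \<Rightarrow> ('r, 'a) relstruct \<Rightarrow> ('r, 'b) relstruct \<Rightarrow> ('a \<Rightarrow> 'b) \<Rightarrow> bool" where
  "iso_between L ar M N f \<longleftrightarrow>
     bij_betw f (universe M) (universe N) \<and>
     (\<forall>R\<in>L. \<forall>xs. length xs = ar R \<and> set xs \<subseteq> universe M \<longrightarrow>
        (xs \<in> rel M R \<longleftrightarrow> map f xs \<in> rel N R))"

definition isomorphic ::
  "'r set \<Rightarrow> ('r \<Rightarrow> nat) \<Rightarrow> ('r, 'a) relstruct \<Rightarrow> ('r, 'b) relstruct \<Rightarrow> bool" where
  "isomorphic L ar M N \<longleftrightarrow> (\<exists>f. iso_between L ar M N f)"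

definition automorphism ::
  "'r set \<Rightarrow> ('r \<Rightarrow> nat) \<Rightarrow> ('r, 'a) relstruct \<Rightarrow> ('a \<Rightarrow> 'a) \<Rightarrow> bool" where
  "automorphism L ar M f \<longleftrightarrow> iso_between L ar M M f"

definition dcl :: "'r set \<Rightarrow> ('r \<Rightarrow> nat) \<Rightarrow> ('r, 'a) relstruct \<Rightarrow> 'a list \<Rightarrow> 'a set" where
  "dcl L ar M as =
     {b \<in> universe M. \<forall>f. automorphism L ar M f \<and> (\<forall>a\<in>set as. f a = a) \<longrightarrow> f b = b}"

definition trivial_dcl :: "'r set \<Rightarrow> ('r \<Rightarrow> nat) \<Rightarrow> ('r, 'a) relstruct \<Rightarrow> bool" where
  "trivial_dcl L ar M \<longleftrightarrow> (\<forall>as. set as \<subseteq> universe M \<longrightarrow> dcl L ar M as = set as)"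

definition nat_structures :: "'r set \<Rightarrow> ('r \<Rightarrow> nat) \<Rightarrow> ('r, nat) relstruct set" where
  "nat_structures L ar = {N. is_structure L ar N \<and> universe N = UNIV}"

text \<open>The measurable space \<open>S\<^sub>L\<close>; the measure carried by \<^const>\<open>sigma\<close> is irrelevant.\<close>

definition structure_space :: "'r set \<Rightarrow> ('r \<Rightarrow> nat) \<Rightarrow> ('r, nat) relstruct measure" where
  "structure_space L ar = sigma (nat_structures L ar)
     {{N \<in> nat_structures L ar. ns \<in> rel N R} | R ns. R \<in> L \<and> length ns = ar R}"

text \<open>
  Logic action: \<open>g\<cdot>N\<close> satisfies \<open>R(g n\<^sub>1, \<dots>, g n\<^sub>j)\<close>
  iff \<open>N\<close> satisfies \<open>R(n\<^sub>1, \<dots>, n\<^sub>j)\<close>.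
\<close>

definition logic_action :: "(nat \<Rightarrow> nat) \<Rightarrow> ('r, nat) relstruct \<Rightarrow> ('r, nat) relstruct" where
  "logic_action g N = \<lparr>universe = g ` universe N, rel = (\<lambda>R. map g ` rel N R)\<rparr>"

definition invariant_measure :: "('r, nat) relstruct measure \<Rightarrow> bool" where
  "invariant_measure \<mu> \<longleftrightarrow>
     (\<forall>g. bij g \<longrightarrow> (\<forall>A\<in>sets \<mu>. emeasure \<mu> (logic_action g ` A) = emeasure \<mu> A))"

text \<open>
  Since \<^const>\<open>emeasure\<close> vanishes outside the \<open>\<sigma>\<close>-algebra, value \<open>1\<close> includes
  measurability of the isomorphism class.
\<close>

definition concentrated_on ::
  "'r set \<Rightarrow> ('r \<Rightarrow> nat) \<Rightarrow> ('r, nat) relstruct measure \<Rightarrow> ('r, 'a) relstruct \<Rightarrow> bool" where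
  "concentrated_on L ar \<mu> M \<longleftrightarrow>
     emeasure \<mu> {N \<in> nat_structures L ar. isomorphic L ar M N} = 1"

lemma space_structure_space: "space (structure_space L ar) = nat_structures L ar"
  unfolding structure_space_def by (intro space_measure_of) auto

lemma sets_structure_space:
  "sets (structure_space L ar) = sigma_sets (nat_structures L ar)
     {{N \<in> nat_structures L ar. ns \<in> rel N R} | R ns. R \<in> L \<and> length ns = ar R}"
  unfolding structure_space_def by (intro sets_measure_of) auto

lemma logic_action_in_nat_structures:
  assumes "bij g" "N \<in> nat_structures L ar"
  shows "logic_action g N \<in> nat_structures L ar"
  using assms
  by (fastforce simp: nat_structures_def is_structure_def logic_action_def bij_is_surj)

lemma iso_between_logic_action:
  assumes "bij g" "universe N = UNIV"
  shows "iso_between L ar N (logic_action g N) g"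
  using assms
  by (auto simp: iso_between_def logic_action_def bij_is_surj
      bij_is_inj inj_image_mem_iff)

end

theory Submission
  imports Defs
begin

text \<open>
  Transfer \<open>M\<close> to the universe of natural numbers and let \<open>G\<close> be its automorphism group. One builds
  a tree of finite stages whose points are labelled injectively by elements of \<open>M\<close>. From one stage
  to the next either a new element is split off from the unassigned mass, or a point \<open>x\<close> is
  duplicated; by trivial definable closure some \<open>g \<in> G\<close> fixes all other labels and moves the label
  of \<open>x\<close>, and the copy is labelled by the moved element. Hence a tuple of distinct branches has a
  well-defined \<open>G\<close>-orbit, independent of the stage at which it is read off. Splitting every point
  infinitely often makes the branch measure (each split halves the mass) atomless, and adding
  realizations of all one-point extensions of all types makes a sequence of independent random
  branches almost surely carry, by back-and-forth, a copy of \<open>M\<close>. The law of this random structure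
  is invariant because the branches are exchangeable. That the isomorphism class of \<open>M\<close> is
  measurable is Scott's theorem.
\<close>

section \<open>Measurability of isomorphism classes\<close>

text \<open>Step \<open>n\<close> puts \<open>n\<close> into both the domain and the range, so the
  union of the increasing lists is the graph of a permutation. The last conclusion keeps, for each
  finite set, one good list inside this graph; relations are later compared through that
  list.\<close>

lemma back_and_forth:
  fixes E :: "(nat \<times> nat) list \<Rightarrow> bool"
  assumes nil: "E []"
    and forward: "\<And>zs x. E zs \<Longrightarrow> x \<notin> fst ` set zs \<Longrightarrow> \<exists>y. E (zs @ [(x, y)])"
    and backward: "\<And>zs y. E zs \<Longrightarrow> y \<notin> snd ` set zs \<Longrightarrow> \<exists>x. E (zs @ [(x, y)])"
    and inj: "\<And>zs z z'. E zs \<Longrightarrow> z \<in> set zs \<Longrightarrow> z' \<in> set zs \<Longrightarrow> fst z = fst z' \<longleftrightarrow> snd z = snd z'"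
  obtains f where "bij f" "\<And>A. finite A \<Longrightarrow> \<exists>zs. E zs \<and> A \<subseteq> fst ` set zs \<and> (\<forall>z\<in>set zs. snd z = f (fst z))"
proof -
  have step: "\<exists>zs'. E zs' \<and> set zs \<subseteq> set zs' \<and> n \<in> fst ` set zs' \<and> n \<in> snd ` set zs'"
    if "E zs" for zs n
  proof -
    obtain zs1 where 1: "E zs1" "set zs \<subseteq> set zs1" "n \<in> fst ` set zs1"
    proof (cases "n \<in> fst ` set zs")
      case False
      from forward[OF \<open>E zs\<close> this] obtain y where "E (zs @ [(n, y)])" ..
      then show ?thesis by (intro that) auto
    qed (use that[of zs] \<open>E zs\<close> in auto)
    show ?thesis
    proof (cases "n \<in> snd ` set zs1")
      case False
      from backward[OF \<open>E zs1\<close> this] obtain x where "E (zs1 @ [(x, n)])" ..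
      then show ?thesis using 1 by (intro exI[of _ "zs1 @ [(x, n)]"]) auto
    qed (use 1 in auto)
  qed
  have "\<exists>Z. \<forall>n. E (Z n) \<and> (set (Z n) \<subseteq> set (Z (Suc n)) \<and> n \<in> fst ` set (Z (Suc n)) \<and> n \<in> snd ` set (Z (Suc n)))"
    by (rule dependent_nat_choice) (use nil step in auto)
  then obtain Z where Z: "\<And>n. E (Z n)" "\<And>n. set (Z n) \<subseteq> set (Z (Suc n))"
    "\<And>n. n \<in> fst ` set (Z (Suc n))" "\<And>n. n \<in> snd ` set (Z (Suc n))"
    by blast
  have mono: "set (Z i) \<subseteq> set (Z j)" if "i \<le> j" for i j
    using that Z(2) by (rule lift_Suc_mono_le[of "\<lambda>n. set (Z n)", rotated])
  define R where "R = (\<Union>n. set (Z n))"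
  have R_inj: "fst z = fst z' \<longleftrightarrow> snd z = snd z'" if "z \<in> R" "z' \<in> R" for z z'
  proof -
    from that obtain i j where "z \<in> set (Z i)" "z' \<in> set (Z j)"
      by (auto simp: R_def)
    then have "z \<in> set (Z (max i j))" "z' \<in> set (Z (max i j))"
      using mono[of i "max i j"] mono[of j "max i j"] by auto
    with Z(1) inj show ?thesis by blast
  qed
  have "\<exists>y. (n, y) \<in> R" for n
    using Z(3)[of n] by (force simp: R_def)
  then obtain f where f: "\<And>n. (n, f n) \<in> R"
    by metis
  have snd_R: "snd z = f (fst z)" if "z \<in> R" for z
    using R_inj[OF that f[of "fst z"]] by simp
  show ?thesis
  proof
    have "inj f"
      using R_inj[OF f f] by (auto intro: injI)
    moreover have "\<exists>x. f x = n" for n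
      using Z(4)[of n] snd_R unfolding R_def by fastforce
    ultimately show "bij f"
      by (metis bij_def surj_def)
    fix A :: "nat set" assume "finite A"
    then obtain k where "A \<subseteq> {..<k}"
      using finite_nat_bounded[of A] by auto
    moreover have "{..<k} \<subseteq> fst ` set (Z k)"
    proof
      fix i assume "i \<in> {..<k}"
      then have "set (Z (Suc i)) \<subseteq> set (Z k)"
        by (intro mono) simp
      with Z(3)[of i] show "i \<in> fst ` set (Z k)"
        by (meson image_mono subsetD)
    qed
    moreover have "\<forall>z\<in>set (Z k). snd z = f (fst z)"
      using snd_R by (auto simp: R_def)
    ultimately show "\<exists>zs. E zs \<and> A \<subseteq> fst ` set zs \<and> (\<forall>z\<in>set zs. snd z = f (fst z))"
      using Z(1) by blast
  qed
qed

section \<open>Basic events and the logic action\<close>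

lemma pred_rel:
  assumes "R \<in> L"
  shows "Measurable.pred (structure_space L ar) (\<lambda>N. ns \<in> rel N R)"
proof (cases "length ns = ar R")
  case True
  with assms have "{N \<in> nat_structures L ar. ns \<in> rel N R} \<in> sets (structure_space L ar)"
    unfolding sets_structure_space by blast
  then show ?thesis
    by (simp add: pred_def space_structure_space)
next
  case False
  with assms have "{N \<in> nat_structures L ar. ns \<in> rel N R} = {}"
    by (auto simp: nat_structures_def is_structure_def)
  then show ?thesis
    unfolding pred_def space_structure_space by (metis sets.empty_sets)
qed

lemma map_mem_rel_logic_action:
  assumes "bij g"
  shows "map g ns \<in> rel (logic_action g N) R \<longleftrightarrow> ns \<in> rel N R"
  using assms by (auto simp: logic_action_def bij_is_inj inj_image_mem_iff)

text \<open>An isomorphism between structures on the natural numbers is a permutation. Outside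
  \<open>L\<close> and at wrong lengths both structures have no tuples, so it carries one structure
  exactly onto the other.\<close>

lemma isomorphic_nat_structures:
  assumes "M \<in> nat_structures L ar" "N \<in> nat_structures L ar" "isomorphic L ar M N"
  obtains g where "bij g" "N = logic_action g M"
proof -
  from assms(3) obtain g where g: "iso_between L ar M N g"
    by (auto simp: isomorphic_def)
  with assms have bij: "bij g" and
    gR: "\<And>R xs. R \<in> L \<Longrightarrow> length xs = ar R \<Longrightarrow> xs \<in> rel M R \<longleftrightarrow> map g xs \<in> rel N R"
    by (auto simp: iso_between_def nat_structures_def)
  have "rel N R = map g ` rel M R" for R
  proof (cases "R \<in> L")
    case True
    have "ns \<in> rel N R \<longleftrightarrow> ns \<in> map g ` rel M R" for ns
    proof -
      have ns: "map g (map (inv g) ns) = ns"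
        using bij by (auto intro!: map_idI simp: bij_is_surj surj_f_inv_f)
      have "ns \<in> map g ` rel M R \<longleftrightarrow> map (inv g) ns \<in> rel M R"
        using bij ns by (metis (mono_tags, lifting) bij_is_inj image_iff inj_map_eq_map)
      moreover have "length ns = ar R" if "ns \<in> rel N R \<or> map (inv g) ns \<in> rel M R"
      proof -
        have "rel M R \<subseteq> {xs. length xs = ar R}" "rel N R \<subseteq> {xs. length xs = ar R}"
          using True assms(1,2) by (auto simp: nat_structures_def is_structure_def)
        with that have "length ns = ar R \<or> length (map (inv g) ns) = ar R" by blast
        then show ?thesis by simp
      qed
      ultimately show ?thesis
        using gR[OF True, of "map (inv g) ns"] ns by auto
    qed
    then show ?thesis by blast
  next
    case False
    with assms show ?thesis by (auto simp: nat_structures_def is_structure_def)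
  qed
  moreover have "universe N = g ` universe M"
    using assms bij by (auto simp: nat_structures_def bij_is_surj)
  ultimately show ?thesis
    by (intro that[OF bij] relstruct.equality) (auto simp: logic_action_def)
qed

text \<open>
  Semantic substitute for formulas of the infinitary logic with countable conjunctions, the list
  being the tuple of free variables.
\<close>

definition inv_pred :: "'r set \<Rightarrow> ('r \<Rightarrow> nat) \<Rightarrow> (('r, nat) relstruct \<Rightarrow> nat list \<Rightarrow> bool) \<Rightarrow> bool" where
  "inv_pred L ar P \<longleftrightarrow>
     (\<forall>ns. Measurable.pred (structure_space L ar) (\<lambda>N. P N ns)) \<and>
     (\<forall>g N ns. bij g \<and> N \<in> nat_structures L ar \<longrightarrow> P (logic_action g N) (map g ns) = P N ns)"

lemma inv_pred_length: "inv_pred L ar (\<lambda>_ ns. Q (length ns))"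
  by (simp add: inv_pred_def)

lemma inv_pred_nth_eq: "inv_pred L ar (\<lambda>_ ns. i < length ns \<and> j < length ns \<and> ns ! i = ns ! j)"
  by (auto simp: inv_pred_def bij_is_inj inj_eq)

lemma inv_pred_rel:
  assumes "R \<in> L"
  shows "inv_pred L ar (\<lambda>N ns. set js \<subseteq> {..<length ns} \<and> map ((!) ns) js \<in> rel N R)"
proof -
  have "map ((!) (map g ns)) js = map g (map ((!) ns) js)" if "set js \<subseteq> {..<length ns}"
    for ns :: "nat list" and g :: "nat \<Rightarrow> nat"
    using that by auto
  then show ?thesis
    using pred_rel[OF assms]
    by (auto simp: inv_pred_def map_mem_rel_logic_action simp del: map_map cong: conj_cong)
qed

lemma inv_pred_not: "inv_pred L ar P \<Longrightarrow> inv_pred L ar (\<lambda>N ns. \<not> P N ns)"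
  unfolding inv_pred_def by (intro conjI allI impI pred_intros_logic) auto

lemma inv_pred_all:
  fixes P :: "'i::countable \<Rightarrow> _"
  shows "(\<And>i. inv_pred L ar (P i)) \<Longrightarrow> inv_pred L ar (\<lambda>N ns. \<forall>i. P i N ns)"
  unfolding inv_pred_def by (intro conjI allI impI pred_intros_countable) auto

text \<open>Quantification over the last variable: since \<open>g\<close> is onto, every witness in
  the moved structure is the image of a witness in the original one.\<close>

lemma inv_pred_ex_append:
  assumes "inv_pred L ar P"
  shows "inv_pred L ar (\<lambda>N ns. \<exists>n. P N (ns @ [n]))"
proof -
  have "(\<exists>n. P (logic_action g N) (map g ns @ [n])) \<longleftrightarrow> (\<exists>n. P N (ns @ [n]))"
    if "bij g" "N \<in> nat_structures L ar" for g N ns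
  proof -
    have "(\<exists>n. P (logic_action g N) (map g ns @ [n])) \<longleftrightarrow> (\<exists>n. P (logic_action g N) (map g (ns @ [n])))"
    proof -
      have "\<exists>k. n = g k" for n
        using \<open>bij g\<close> by (metis bij_pointE)
      then have "(\<exists>n. Q n) \<longleftrightarrow> (\<exists>n. Q (g n))" for Q
        by metis
      then show ?thesis by simp
    qed
    also have "\<dots> \<longleftrightarrow> (\<exists>n. P N (ns @ [n]))"
      using assms that unfolding inv_pred_def by blast
    finally show ?thesis .
  qed
  with assms show ?thesis
    unfolding inv_pred_def by (intro conjI allI impI pred_intros_countable) auto
qed

text \<open>The quantifier-free type of a tuple. Arguments are given by index lists
  \<open>js\<close>, so that tuples in different structures are compared position by
  position.\<close>

definition same_diagram ::
  "'r set \<Rightarrow> ('r, nat) relstruct \<Rightarrow> nat list \<Rightarrow> ('r, nat) relstruct \<Rightarrow> nat list \<Rightarrow> bool" where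
  "same_diagram L M as N bs \<longleftrightarrow> length bs = length as \<and>
     (\<forall>i j. i < length as \<and> j < length as \<longrightarrow> (as ! i = as ! j \<longleftrightarrow> bs ! i = bs ! j)) \<and>
     (\<forall>R\<in>L. \<forall>js. set js \<subseteq> {..<length as} \<longrightarrow>
        (map ((!) as) js \<in> rel M R \<longleftrightarrow> map ((!) bs) js \<in> rel N R))"

lemma pred_same_diagram:
  assumes "countable L"
  shows "Measurable.pred (structure_space L ar) (\<lambda>N. same_diagram L M as N bs)"
proof -
  note [measurable] = pred_rel
  have [measurable]: "Measurable.pred (structure_space L ar) (\<lambda>N. \<forall>R\<in>L. \<forall>js. set js \<subseteq> {..<length as} \<longrightarrow>
        (map ((!) as) js \<in> rel M R \<longleftrightarrow> map ((!) bs) js \<in> rel N R))"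
    using assms by measurable
  show ?thesis
    unfolding same_diagram_def by measurable
qed

lemma same_diagram_logic_action:
  assumes "bij g" "same_diagram L M as N bs"
  shows "same_diagram L M as (logic_action g N) (map g bs)"
proof -
  have "map ((!) (map g bs)) js = map g (map ((!) bs) js)" if "set js \<subseteq> {..<length as}" for js
    using that assms(2) by (auto simp: same_diagram_def)
  with assms show ?thesis
    by (auto simp: same_diagram_def map_mem_rel_logic_action bij_is_inj inj_eq simp del: map_map)
qed

text \<open>
  Scott's theorem. Agreement of two tuples of \<open>M\<close> on all invariant predicates has the
  back-and-forth property, since a single invariant predicate (a countable conjunction) isolates
  each class; this replaces the usual transfinite iteration.
\<close>

theorem isomorphism_class_measurable:
  fixes M :: "('r, nat) relstruct"
  assumes L: "countable L" and M: "M \<in> nat_structures L ar"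
  shows "{N \<in> nat_structures L ar. isomorphic L ar M N} \<in> sets (structure_space L ar)"
proof -
  define equiv where "equiv as bs \<longleftrightarrow> (\<forall>P. inv_pred L ar P \<longrightarrow> P M as = P M bs)" for as bs
  have equivD: "P M as = P M bs" if "equiv as bs" "inv_pred L ar P" for as bs P
    using that by (simp add: equiv_def)
  \<comment> \<open>For each \<open>bs\<close> outside the class of \<open>as\<close> take an
    invariant predicate true of \<open>as\<close> and false of \<open>bs\<close>. There are
    countably many lists, so the conjunction is again an invariant predicate, and it defines the
    class of \<open>as\<close> in \<open>M\<close>.\<close>
  have "\<exists>\<phi>. inv_pred L ar \<phi> \<and> (\<forall>bs. \<phi> M bs \<longleftrightarrow> equiv as bs)" for as
  proof -
    have "\<exists>P. inv_pred L ar P \<and> P M as \<and> (\<not> equiv as bs \<longrightarrow> \<not> P M bs)" for bs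
    proof (cases "equiv as bs")
      case True
      then show ?thesis using inv_pred_length[of L ar "\<lambda>_. True"] by blast
    next
      case False
      then obtain P where "inv_pred L ar P" "P M as \<noteq> P M bs"
        by (auto simp: equiv_def)
      then show ?thesis
        using inv_pred_not[of L ar P] by metis
    qed
    then obtain P where P: "\<And>bs. inv_pred L ar (P bs)" "\<And>bs. P bs M as"
      "\<And>bs. \<not> equiv as bs \<Longrightarrow> \<not> P bs M bs"
      by metis
    have "(\<forall>cs. P cs M bs) \<longleftrightarrow> equiv as bs" for bs
      using P by (auto simp: equiv_def)
    with inv_pred_all[of L ar P, OF P(1)] show ?thesis by blast
  qed
  then obtain \<phi> where \<phi>: "\<And>as. inv_pred L ar (\<phi> as)" "\<And>as bs. \<phi> as M bs \<longleftrightarrow> equiv as bs"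
    by metis
  have [measurable]: "Measurable.pred (structure_space L ar) (\<lambda>N. \<phi> as N ns)" for as ns
    using \<phi>(1) by (simp add: inv_pred_def)
  have \<phi>_action: "\<phi> as (logic_action g M) (map g ns) \<longleftrightarrow> equiv as ns" if "bij g" for as g ns
    using \<phi> M that by (auto simp: inv_pred_def)
  have equiv_refl: "equiv as as" for as
    by (simp add: equiv_def)
  have equiv_sym: "equiv as bs \<Longrightarrow> equiv bs as" for as bs
    unfolding equiv_def by auto
  \<comment> \<open>That some \<open>n\<close> extends the tuple into the class of
    \<open>as @ [c]\<close> is an invariant predicate true of \<open>as\<close>, hence also of
    \<open>bs\<close>.\<close>
  have extend: "\<exists>d. equiv (as @ [c]) (bs @ [d])" if "equiv as bs" for as bs c
  proof -
    have "inv_pred L ar (\<lambda>N ns. \<exists>n. \<phi> (as @ [c]) N (ns @ [n]))"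
      by (intro inv_pred_ex_append \<phi>)
    from equivD[OF that this] show ?thesis
      using \<phi>(2) equiv_refl by blast
  qed
  have diagram: "same_diagram L M as M bs" if "equiv as bs" for as bs
  proof -
    note P = equivD[OF that]
    have len: "length bs = length as"
      using P[OF inv_pred_length[of L ar "\<lambda>l. l = length as"]] by simp
    have "as ! i = as ! j \<longleftrightarrow> bs ! i = bs ! j" if "i < length as" "j < length as" for i j
      using P[OF inv_pred_nth_eq[of L ar i j]] len that by simp
    moreover have "map ((!) as) js \<in> rel M R \<longleftrightarrow> map ((!) bs) js \<in> rel M R"
      if "R \<in> L" "set js \<subseteq> {..<length as}" for R js
      using P[OF inv_pred_rel[of R L ar js]] len that by simp
    ultimately show ?thesis
      using len unfolding same_diagram_def by blast
  qed

  \<comment> \<open>The Scott sentence of \<open>M\<close>: the relation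
    \<open>\<phi> as N ns\<close> holds of the empty tuples, preserves diagrams and has both
    extension properties. All quantifiers range over countable sets.\<close>
  define scott where "scott N \<longleftrightarrow> \<phi> [] N [] \<and> (\<forall>as ns. \<phi> as N ns \<longrightarrow> same_diagram L M as N ns \<and>
      (\<forall>c. \<exists>d. \<phi> (as @ [c]) N (ns @ [d])) \<and> (\<forall>d. \<exists>c. \<phi> (as @ [c]) N (ns @ [d])))" for N
  have "scott N \<longleftrightarrow> isomorphic L ar M N" if N: "N \<in> nat_structures L ar" for N
  proof
    assume "isomorphic L ar M N"
    from isomorphic_nat_structures[OF M N this]
    obtain g where g: "bij g" and N_eq: "N = logic_action g M" .
    have map_inv: "map g (map (inv g) ns) = ns" for ns
      using g by (auto intro!: map_idI simp: bij_is_surj surj_f_inv_f)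
    have ext: "same_diagram L M as N ns \<and>
      (\<forall>c. \<exists>d. \<phi> (as @ [c]) N (ns @ [d])) \<and> (\<forall>d. \<exists>c. \<phi> (as @ [c]) N (ns @ [d]))"
      if "\<phi> as N ns" for as ns
    proof -
      define ms where "ms = map (inv g) ns"
      have ns: "ns = map g ms"
        unfolding ms_def by (simp only: map_inv)
      have equiv: "equiv as ms"
        using that \<phi>_action[OF g] by (simp add: N_eq ns)
      have snoc: "ns @ [g d] = map g (ms @ [d])" for d
        by (simp add: ns)
      have "\<exists>d. \<phi> (as @ [c]) N (ns @ [d])" for c
        using extend[OF equiv, of c] \<phi>_action[OF g] snoc N_eq by metis
      moreover have "\<exists>c. \<phi> (as @ [c]) N (ns @ [d])" for d
      proof -
        obtain e where e: "d = g e" using g by (metis bij_pointE)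
        from extend[OF equiv_sym[OF equiv], of e] obtain c where "equiv (ms @ [e]) (as @ [c])" ..
        then have "equiv (as @ [c]) (ms @ [e])" by (rule equiv_sym)
        then have "\<phi> (as @ [c]) N (map g (ms @ [e]))"
          using \<phi>_action[OF g] N_eq by blast
        then show ?thesis using e snoc by metis
      qed
      moreover have "same_diagram L M as N ns"
        using same_diagram_logic_action[OF g diagram[OF equiv]] by (simp add: N_eq ns)
      ultimately show ?thesis by blast
    qed
    have "\<phi> [] N []"
      using \<phi>_action[OF g, of "[]" "[]"] equiv_refl by (simp add: N_eq)
    with ext show "scott N" by (simp add: scott_def)
  next
    assume scott: "scott N"
    define E where "E zs \<longleftrightarrow> \<phi> (map fst zs) N (map snd zs)" for zs
    have E_diagram: "same_diagram L M (map fst zs) N (map snd zs)" if "E zs" for zs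
      using scott that unfolding scott_def E_def by blast
    obtain f where f: "bij f" and
      E_f: "\<And>A. finite A \<Longrightarrow> \<exists>zs. E zs \<and> A \<subseteq> fst ` set zs \<and> (\<forall>z\<in>set zs. snd z = f (fst z))"
    proof (rule back_and_forth[of E])
      show "E []" using scott by (simp add: E_def scott_def)
      show "\<exists>y. E (zs @ [(x, y)])" if "E zs" for zs x
        using scott that unfolding scott_def E_def by simp
      show "\<exists>x. E (zs @ [(x, y)])" if "E zs" for zs y
        using scott that unfolding scott_def E_def by simp
      show "fst z = fst z' \<longleftrightarrow> snd z = snd z'" if "E zs" "z \<in> set zs" "z' \<in> set zs" for zs z z'
        using E_diagram[OF that(1)] that(2,3) by (auto simp: same_diagram_def in_set_conv_nth)
    qed auto
    have "xs \<in> rel M R \<longleftrightarrow> map f xs \<in> rel N R" if R: "R \<in> L" for R xs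
    proof -
      obtain zs where zs: "E zs" "set xs \<subseteq> fst ` set zs" "\<forall>z\<in>set zs. snd z = f (fst z)"
        using E_f[of "set xs"] by auto
      have "\<forall>x\<in>set xs. \<exists>j<length zs. fst (zs ! j) = x"
        using zs(2) by (fastforce simp: in_set_conv_nth)
      \<comment> \<open>Positions in \<open>zs\<close> of the entries of \<open>xs\<close>; they
        form the index list at which the diagrams are compared.\<close>
      then obtain h where h: "\<And>x. x \<in> set xs \<Longrightarrow> h x < length zs \<and> fst (zs ! h x) = x"
        by metis
      have "map ((!) (map fst zs)) (map h xs) = xs"
        using h by (auto intro: map_idI)
      moreover have "map ((!) (map snd zs)) (map h xs) = map f xs"
        using h zs(3) by auto
      moreover have "set (map h xs) \<subseteq> {..<length (map fst zs)}"
        using h by auto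
      ultimately show ?thesis
        using E_diagram[OF zs(1)] R unfolding same_diagram_def by metis
    qed
    then have "iso_between L ar M N f"
      using f M N by (auto simp: iso_between_def nat_structures_def)
    then show "isomorphic L ar M N"
      by (auto simp: isomorphic_def)
  qed
  then have "{N \<in> nat_structures L ar. isomorphic L ar M N} = {N \<in> space (structure_space L ar). scott N}"
    by (auto simp: space_structure_space)
  also have "\<dots> \<in> sets (structure_space L ar)"
    using pred_same_diagram[OF L, measurable] unfolding scott_def by measurable
  finally show ?thesis .
qed

section \<open>Duplicating and adding points\<close>

text \<open>All that the construction uses of the automorphism group; \<open>move\<close> is trivial
  definable closure over finite sets.\<close>

locale trivial_dcl_group =
  fixes G :: "(nat \<Rightarrow> nat) set"
  assumes bij: "g \<in> G \<Longrightarrow> bij g"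
    and id_mem: "id \<in> G"
    and comp_mem: "g \<in> G \<Longrightarrow> h \<in> G \<Longrightarrow> g \<circ> h \<in> G"
    and inv_mem: "g \<in> G \<Longrightarrow> inv g \<in> G"
    and move: "finite A \<Longrightarrow> b \<notin> A \<Longrightarrow> \<exists>g\<in>G. (\<forall>a\<in>A. g a = a) \<and> g b \<noteq> b"
begin

text \<open>
  At stage \<open>n\<close> there are the points \<open>0, \<dots>, n\<close>. Point \<open>i \<noteq> 0\<close> stands for the element \<open>m i\<close>,
  point \<open>0\<close> for the mass that is not yet assigned to an element (\<open>m 0\<close> is junk), and the new
  point \<open>Suc k\<close> of stage \<open>Suc k\<close> splits off from \<open>p k\<close>.
\<close>

definition splitting :: "(nat \<Rightarrow> nat) \<Rightarrow> (nat \<Rightarrow> nat) \<Rightarrow> nat \<Rightarrow> bool" where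
  "splitting m p k \<longleftrightarrow> p k \<le> k \<and>
     (p k \<noteq> 0 \<longrightarrow> (\<exists>g\<in>G. (\<forall>i\<in>{1..k} - {p k}. g (m i) = m i) \<and> g (m (p k)) = m (Suc k)))"

definition approximation :: "nat \<Rightarrow> (nat \<Rightarrow> nat) \<Rightarrow> (nat \<Rightarrow> nat) \<Rightarrow> bool" where
  "approximation n m p \<longleftrightarrow> inj_on m {1..n} \<and> (\<forall>k<n. splitting m p k)"

text \<open>Stage \<open>n\<close> has labels up to index \<open>n\<close> but arises from only
  \<open>n\<close> splits, hence the two ranges.\<close>

definition agree :: "nat \<Rightarrow> (nat \<Rightarrow> nat) \<Rightarrow> (nat \<Rightarrow> nat) \<Rightarrow> (nat \<Rightarrow> nat) \<Rightarrow> (nat \<Rightarrow> nat) \<Rightarrow> bool" where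
  "agree n m p m' p' \<longleftrightarrow> (\<forall>i\<le>n. m' i = m i) \<and> (\<forall>i<n. p' i = p i)"

text \<open>The orbit of \<open>as\<close> extended by \<open>b\<close> is a type over that of
  \<open>as\<close>. If the labels of the points \<open>s\<close> lie in the orbit of
  \<open>as\<close>, a labelled point \<open>y\<close> has to realize this type over them, by one
  common \<open>g\<close>.\<close>

definition realizes :: "nat \<Rightarrow> (nat \<Rightarrow> nat) \<Rightarrow> nat list \<Rightarrow> nat \<Rightarrow> nat list \<Rightarrow> bool" where
  "realizes n m as b s \<longleftrightarrow> (\<exists>g\<in>G. map (g \<circ> m) s = as) \<longrightarrow>
     (\<exists>y\<in>{1..n}. \<exists>g\<in>G. map (g \<circ> m) s = as \<and> g (m y) = b)"

lemma splitting_cong: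
  assumes "agree n m p m' p'" "k < n"
  shows "splitting m' p' k \<longleftrightarrow> splitting m p k"
proof (cases "p k \<le> k")
  case True
  have "m' i = m i" if "i \<in> {1..k} - {p k}" for i
    using that assms by (auto simp: agree_def)
  moreover have "p' k = p k" "m' (p k) = m (p k)" "m' (Suc k) = m (Suc k)"
    using True assms by (auto simp: agree_def)
  ultimately show ?thesis
    by (simp add: splitting_def)
next
  case False
  with assms show ?thesis by (simp add: splitting_def agree_def)
qed

lemma approximation_Suc:
  assumes "approximation n m p" "v \<notin> m ` {1..n}" "splitting (m(Suc n := v)) (p(n := j)) n"
  shows "approximation (Suc n) (m(Suc n := v)) (p(n := j))"
proof -
  have "agree n m p (m(Suc n := v)) (p(n := j))"
    by (simp add: agree_def)
  note splitting_cong[OF this]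
  moreover have "inj_on (m(Suc n := v)) {1..Suc n}"
  proof -
    have "inj_on (m(Suc n := v)) {1..n}"
      using assms(1,2) by (intro inj_on_fun_updI) (auto simp: approximation_def)
    moreover have "m(Suc n := v) ` {1..n} = m ` {1..n}"
      by (intro image_cong) auto
    ultimately show ?thesis
      using assms(2) by (simp add: atLeastAtMostSuc_conv)
  qed
  ultimately show ?thesis
    using assms(1,3) unfolding approximation_def by (metis less_Suc_eq)
qed

lemma approximation_add_point:
  assumes "approximation n m p" "v \<notin> m ` {1..n}"
  shows "approximation (Suc n) (m(Suc n := v)) (p(n := 0))"
  by (rule approximation_Suc[OF assms]) (simp add: splitting_def)

text \<open>Trivial definable closure yields a \<open>g\<close> that fixes all other labels and
  moves \<open>m j\<close>. By injectivity \<open>g (m j)\<close> also differs from the fixed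
  labels, so it is a fresh label for the copy. For point \<open>0\<close> any fresh label will
  do.\<close>

lemma approximation_split_point:
  assumes "approximation n m p" "j \<le> n"
  shows "\<exists>v. approximation (Suc n) (m(Suc n := v)) (p(n := j))"
proof (cases "j = 0")
  case True
  obtain v where "v \<notin> m ` {1..n}"
    using ex_new_if_finite[of "m ` {1..n}"] by auto
  with True show ?thesis
    using approximation_add_point[OF assms(1)] by blast
next
  case False
  define A where "A = m ` ({1..n} - {j})"
  have ins: "m ` {1..n} = insert (m j) A"
    using False assms(2) by (auto simp: A_def)
  have "m j \<notin> A"
    using assms False inj_on_image_mem_iff[of m "{1..n}" j "{1..n} - {j}"]
    by (auto simp: A_def approximation_def)
  then obtain g where g: "g \<in> G" "\<And>a. a \<in> A \<Longrightarrow> g a = a" "g (m j) \<noteq> m j"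
    using move[of A "m j"] by (auto simp: A_def)
  have "inj g"
    using bij[OF g(1)] by (rule bij_is_inj)
  then have "g (m j) \<notin> A"
    using g(2) \<open>m j \<notin> A\<close> by (metis inj_eq)
  then have "g (m j) \<notin> m ` {1..n}"
    using g(3) ins by auto
  moreover have "splitting (m(Suc n := g (m j))) (p(n := j)) n"
    using g assms(2) by (auto simp: splitting_def A_def intro!: bexI[of _ g])
  ultimately show ?thesis
    using approximation_Suc[OF assms(1)] by blast
qed

text \<open>Later stages keep the old labels, so the premise for \<open>s\<close> does not change
  and the witness \<open>y\<close> remains available.\<close>

lemma realizes_mono:
  assumes "realizes n m as b s" "n \<le> n'" "agree n m p m' p'" "set s \<subseteq> {..n}"
  shows "realizes n' m' as b s"
proof -
  have eq: "map (g \<circ> m') s = map (g \<circ> m) s" for g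
    using assms by (auto simp: agree_def)
  have "m' y = m y" if "y \<le> n" for y
    using that assms by (auto simp: agree_def)
  with assms(1,2) show ?thesis
    unfolding realizes_def eq by (metis atLeastAtMost_iff order_trans)
qed

lemma agree_trans:
  "agree n m p m' p' \<Longrightarrow> agree n' m' p' m'' p'' \<Longrightarrow> n \<le> n' \<Longrightarrow> agree n m p m'' p''"
  by (simp add: agree_def)

text \<open>Induction over \<open>S\<close>: an unrealized tuple gets a new point with label
  \<open>inv g b\<close>, split off from point \<open>0\<close>. Adding points never destroys what
  is already realized.\<close>

lemma realize_all:
  assumes "approximation n m p" "finite S" "\<And>s. s \<in> S \<Longrightarrow> set s \<subseteq> {1..n}"
  shows "\<exists>n' m' p'. n \<le> n' \<and> approximation n' m' p' \<and> agree n m p m' p' \<and>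
     (\<forall>k\<in>{n..<n'}. p' k = 0) \<and> (\<forall>s\<in>S. realizes n' m' as b s)"
  using assms(2,3)
proof (induction S rule: finite_induct)
  case empty
  with assms(1) show ?case
    by (intro exI[of _ n] exI[of _ m] exI[of _ p]) (simp add: agree_def)
next
  case (insert s S)
  then obtain n' m' p' where IH: "n \<le> n'" "approximation n' m' p'" "agree n m p m' p'"
    "\<forall>k\<in>{n..<n'}. p' k = 0" "\<forall>s\<in>S. realizes n' m' as b s"
    by auto
  have S: "set t \<subseteq> {..n'}" if "t \<in> insert s S" for t
    using insert.prems[OF that] IH(1) by auto
  show ?case
  proof (cases "realizes n' m' as b s")
    case True
    with IH show ?thesis by blast
  next
    case False
    then obtain g where g: "g \<in> G" "map (g \<circ> m') s = as"
      and new: "\<And>y h. y \<in> {1..n'} \<Longrightarrow> h \<in> G \<Longrightarrow> map (h \<circ> m') s = as \<Longrightarrow> h (m' y) \<noteq> b"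
      by (auto simp: realizes_def)
    define v where "v = inv g b"
    have gv: "g v = b"
      using bij[OF g(1)] by (simp add: v_def bij_is_surj surj_f_inv_f)
    \<comment> \<open>An existing point with label \<open>v\<close> would already realize
      \<open>b\<close> through \<open>g\<close>.\<close>
    have v: "v \<notin> m' ` {1..n'}"
      using new[OF _ g] gv by blast
    define m'' p'' where "m'' = m'(Suc n' := v)" and "p'' = p'(n' := 0)"
    have agree': "agree n' m' p' m'' p''"
      by (simp add: agree_def m''_def p''_def)
    have "approximation (Suc n') m'' p''"
      unfolding m''_def p''_def by (rule approximation_add_point[OF IH(2) v])
    moreover have "agree n m p m'' p''"
      using IH(3) agree' IH(1) by (rule agree_trans)
    moreover have "\<forall>k\<in>{n..<Suc n'}. p'' k = 0"
      using IH(4) by (auto simp: p''_def)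
    moreover have "realizes (Suc n') m'' as b t" if "t \<in> S" for t
      using realizes_mono[OF _ _ agree'] IH(5) S that by auto
    moreover have "realizes (Suc n') m'' as b s"
    proof -
      have "map (g \<circ> m'') s = map (g \<circ> m') s"
        using S[of s] by (auto simp: m''_def)
      then have "map (g \<circ> m'') s = as \<and> g (m'' (Suc n')) = b"
        using g gv by (simp add: m''_def)
      then show ?thesis
        unfolding realizes_def using g(1) by (intro impI bexI[of _ "Suc n'"] bexI[of _ g]) auto
    qed
    ultimately show ?thesis
      using IH(1) by (intro exI[of _ "Suc n'"] exI[of _ m''] exI[of _ p'']) auto
  qed
qed

text \<open>
  Between the stages \<open>n\<^sub>1\<close> and \<open>n\<^sub>2\<close> only point \<open>0\<close> is split, so that a sample whose position at
  stage \<open>n\<^sub>1\<close> is nonzero has the same position at stage \<open>n\<^sub>2\<close>.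
\<close>

definition extension_at :: "nat \<Rightarrow> nat \<Rightarrow> (nat \<Rightarrow> nat) \<Rightarrow> (nat \<Rightarrow> nat) \<Rightarrow> nat list \<Rightarrow> nat \<Rightarrow> bool" where
  "extension_at n1 n2 m p as b \<longleftrightarrow> n1 \<le> n2 \<and> (\<forall>k\<in>{n1..<n2}. p k = 0) \<and>
     (\<forall>s. set s \<subseteq> {1..n1} \<longrightarrow> realizes n2 m as b s)"

lemma extension_at_cong:
  assumes "agree n m p m' p'" "n2 \<le> n" "extension_at n1 n2 m p as b"
  shows "extension_at n1 n2 m' p' as b"
proof -
  have "agree n2 m p m' p'"
    using assms(1,2) by (simp add: agree_def)
  moreover have "set s \<subseteq> {..n2}" if "set s \<subseteq> {1..n1}" for s
    using that assms(3) by (auto simp: extension_at_def)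
  moreover have "\<forall>k\<in>{n1..<n2}. p' k = 0"
    using assms by (auto simp: extension_at_def agree_def)
  ultimately show ?thesis
    using assms(3) unfolding extension_at_def by (blast intro: realizes_mono[OF _ order_refl])
qed

text \<open>First point \<open>j\<close> is split, or point \<open>0\<close> if \<open>j\<close>
  does not exist yet; then the type of \<open>b\<close> over \<open>as\<close> is realized over all
  tuples of points present.\<close>

lemma approximation_step:
  assumes "approximation n m p"
  shows "\<exists>n' m' p'. n < n' \<and> approximation n' m' p' \<and> agree n m p m' p' \<and>
     (j \<le> n \<longrightarrow> p' n = j) \<and> (\<exists>n1\<ge>n. \<exists>n2\<le>n'. extension_at n1 n2 m' p' as b)"
proof -
  define j' where "j' = (if j \<le> n then j else 0)"
  have "j' \<le> n"
    by (simp add: j'_def)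
  from approximation_split_point[OF assms this]
  obtain v where v: "approximation (Suc n) (m(Suc n := v)) (p(n := j'))" ..
  \<comment> \<open>Only tuples of the length of \<open>as\<close> can be carried to
    \<open>as\<close>; restricting to them makes \<open>S\<close> finite.\<close>
  define S where "S = {s. set s \<subseteq> {1..Suc n} \<and> length s = length as}"
  have "finite S"
    unfolding S_def by (rule finite_lists_length_eq) simp
  from realize_all[OF v this, of as b]
  obtain n' m' p' where *: "Suc n \<le> n'" "approximation n' m' p'"
    "agree (Suc n) (m(Suc n := v)) (p(n := j')) m' p'" "\<forall>k\<in>{Suc n..<n'}. p' k = 0"
    "\<forall>s\<in>S. realizes n' m' as b s"
    by (auto simp: S_def)
  have "realizes n' m' as b s" if "set s \<subseteq> {1..Suc n}" for s
  proof (cases "length s = length as")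
    case True
    with that * show ?thesis by (simp add: S_def)
  next
    case False
    then show ?thesis by (auto simp: realizes_def dest: map_eq_imp_length_eq)
  qed
  with * have "extension_at (Suc n) n' m' p' as b"
    by (simp add: extension_at_def)
  then have "\<exists>n1\<ge>n. \<exists>n2\<le>n'. extension_at n1 n2 m' p' as b"
    by (intro exI[of _ "Suc n"] exI[of _ n'] conjI) auto
  moreover have "agree n m p m' p'" "j \<le> n \<longrightarrow> p' n = j"
    using *(3) by (auto simp: agree_def j'_def)
  ultimately show ?thesis
    using *(1,2) by (intro exI[of _ n'] exI[of _ m'] exI[of _ p']) (simp add: Suc_le_eq)
qed

text \<open>A task consists of a point to split and a type to realize. Each one is attended to at
  arbitrarily late stages, and the finite stages extend each other, so they have a limit.\<close>

theorem ex_splitting_sequence: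
  obtains m p where "inj_on m {1..}" "\<And>k. splitting m p k" "\<And>j n. \<exists>k\<ge>n. p k = j"
    "\<And>as b n. \<exists>n1\<ge>n. \<exists>n2. extension_at n1 n2 m p as b"
proof -
  \<comment> \<open>The first component of the pair coded by \<open>t\<close> names the task, so
    every task recurs for arbitrarily large \<open>t\<close>.\<close>
  define task :: "nat \<Rightarrow> nat \<times> nat list \<times> nat" where "task t = from_nat (fst (prod_decode t))" for t
  have task: "\<exists>t\<ge>n. task t = x" for x n
    by (intro exI[of _ "prod_encode (to_nat x, n)"]) (simp add: task_def le_prod_encode_2)
  define Q where "Q = (\<lambda>t (n, m, p) (n', m', p'). n < n' \<and> agree n m p m' p' \<and>
     (case task t of (j, as, b) \<Rightarrow> (j \<le> n \<longrightarrow> p' n = j) \<and>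
        (\<exists>n1\<ge>n. \<exists>n2\<le>n'. extension_at n1 n2 m' p' as b)))"
  have "\<exists>Z. \<forall>t. (case Z t of (n, m, p) \<Rightarrow> approximation n m p) \<and> Q t (Z t) (Z (Suc t))"
  proof (rule dependent_nat_choice)
    have "approximation 0 id id" by (simp add: approximation_def)
    then show "\<exists>z. case z of (n, m, p) \<Rightarrow> approximation n m p" by auto
  next
    fix z t assume z: "case z of (n, m, p) \<Rightarrow> approximation n m p"
    obtain n m p where z_eq: "z = (n, m, p)" by (cases z)
    obtain j as b where t: "task t = (j, as, b)" by (cases "task t")
    from z z_eq have "approximation n m p" by simp
    from approximation_step[OF this, of j as b] obtain n' m' p' where
      "n < n'" "approximation n' m' p'" "agree n m p m' p'" "j \<le> n \<longrightarrow> p' n = j"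
      "\<exists>n1\<ge>n. \<exists>n2\<le>n'. extension_at n1 n2 m' p' as b"
      by blast
    then show "\<exists>z'. (case z' of (n, m, p) \<Rightarrow> approximation n m p) \<and> Q t z z'"
      by (intro exI[of _ "(n', m', p')"]) (simp add: Q_def z_eq t)
  qed
  then obtain Z where "\<forall>t. (case Z t of (n, m, p) \<Rightarrow> approximation n m p) \<and> Q t (Z t) (Z (Suc t))" ..
  then have Z: "case Z t of (n, m, p) \<Rightarrow> approximation n m p" "Q t (Z t) (Z (Suc t))" for t
    by simp_all
  define N mm pp where "N t = fst (Z t)" and "mm t = fst (snd (Z t))" and "pp t = snd (snd (Z t))" for t
  have Z_eq: "Z t = (N t, mm t, pp t)" for t
    by (simp add: N_def mm_def pp_def)
  have appr: "approximation (N t) (mm t) (pp t)" for t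
    using Z(1)[of t] by (simp add: Z_eq)
  have Z_step: "N t < N (Suc t)" "agree (N t) (mm t) (pp t) (mm (Suc t)) (pp (Suc t))" for t
    using Z(2)[of t] by (simp_all add: Z_eq Q_def split: prod.splits)
  have task_step: "j \<le> N t \<longrightarrow> pp (Suc t) (N t) = j"
    "\<exists>n1\<ge>N t. \<exists>n2\<le>N (Suc t). extension_at n1 n2 (mm (Suc t)) (pp (Suc t)) as b"
    if "task t = (j, as, b)" for t j as b
    using Z(2)[of t] that by (simp_all add: Z_eq Q_def)
  have "strict_mono N"
    using Z_step(1) by (simp add: strict_mono_Suc_iff)
  then have N_mono: "N t \<le> N t'" if "t \<le> t'" for t t'
    using that by (simp add: strict_mono_less_eq)
  have N_ge: "t \<le> N t" for t
    using \<open>strict_mono N\<close> by (rule strict_mono_imp_increasing)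
  have agree: "agree (N t) (mm t) (pp t) (mm t') (pp t')" if "t \<le> t'" for t t'
    using that
  proof (induction rule: dec_induct)
    case base
    show ?case by (simp add: agree_def)
  next
    case (step u)
    show ?case
      by (rule agree_trans[OF step.IH Z_step(2)]) (use step.hyps N_mono in auto)
  qed
  \<comment> \<open>Since \<open>i \<le> N i\<close>, label \<open>i\<close> is settled at step
    \<open>i\<close>. Splits are settled only strictly below \<open>N t\<close>, so
    \<open>p k\<close> is read at step \<open>Suc k\<close>.\<close>
  define m p where "m i = mm i i" and "p k = pp (Suc k) k" for i k
  have lim: "agree (N t) (mm t) (pp t) m p" for t
  proof -
    have "mm i i = mm t i" if "i \<le> N t" for i
      using agree[of i t] agree[of t i] that N_ge[of i] by (cases "i \<le> t") (auto simp: agree_def)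
    moreover have "pp (Suc k) k = pp t k" if "k < N t" for k
      using agree[of "Suc k" t] agree[of t "Suc k"] that N_ge[of "Suc k"]
      by (cases "Suc k \<le> t") (auto simp: agree_def)
    ultimately show ?thesis
      by (simp add: agree_def m_def p_def)
  qed
  show ?thesis
  proof
    show "inj_on m {1..}"
    proof (rule inj_onI)
      fix x y assume xy: "x \<in> {1..}" "y \<in> {1..}" "m x = m y"
      define t where "t = max x y"
      have "x \<le> N t" "y \<le> N t"
        using N_ge[of t] by (auto simp: t_def)
      with xy lim[of t] have "mm t x = mm t y"
        by (auto simp: agree_def)
      moreover have "inj_on (mm t) {1..N t}"
        using appr[of t] by (simp add: approximation_def)
      ultimately show "x = y"
        using xy \<open>x \<le> N t\<close> \<open>y \<le> N t\<close> by (auto dest: inj_onD)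
    qed
    show "splitting m p k" for k
      using splitting_cong[OF lim[of "Suc k"]] appr[of "Suc k"] N_ge[of "Suc k"]
      by (auto simp: approximation_def)
    show "\<exists>k\<ge>n. p k = j" for j n
    proof -
      \<comment> \<open>From step \<open>j\<close> on the point \<open>j\<close> exists, so the task
        really splits it, namely at stage \<open>N t\<close>.\<close>
      obtain t where t: "t \<ge> max n j" "task t = (j, [], 0)"
        using task by blast
      have "p (N t) = pp (Suc t) (N t)"
        using lim[of "Suc t"] Z_step(1)[of t] by (auto simp: agree_def)
      also have "\<dots> = j"
        using task_step(1)[OF t(2)] t(1) N_ge[of t] by auto
      finally show ?thesis
        using t(1) N_ge[of t] by (intro exI[of _ "N t"]) auto
    qed
    show "\<exists>n1\<ge>n. \<exists>n2. extension_at n1 n2 m p as b" for as b n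
    proof -
      obtain t where t: "t \<ge> n" "task t = (0, as, b)"
        using task by blast
      from task_step(2)[OF t(2)] obtain n1 n2 where
        "n1 \<ge> N t" "n2 \<le> N (Suc t)" "extension_at n1 n2 (mm (Suc t)) (pp (Suc t)) as b"
        by blast
      then show ?thesis
        using extension_at_cong[OF lim] t(1) N_ge[of t] by (meson order_trans)
    qed
  qed
qed

end

section \<open>Structures on generic samples\<close>

lemma iso_between_inv_into:
  assumes "iso_between L ar M N f"
  shows "iso_between L ar N M (inv_into (universe M) f)"
proof -
  let ?h = "inv_into (universe M) f"
  have f: "bij_betw f (universe M) (universe N)"
    using assms by (simp add: iso_between_def)
  then have h: "bij_betw ?h (universe N) (universe M)"
    by (rule bij_betw_inv_into)
  have fh: "f (?h y) = y" if "y \<in> universe N" for y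
    using f that by (rule bij_betw_inv_into_right)
  have "ys \<in> rel N R \<longleftrightarrow> map ?h ys \<in> rel M R"
    if "R \<in> L" "length ys = ar R" "set ys \<subseteq> universe N" for R ys
  proof -
    have "map f (map ?h ys) = ys"
      using that(3) fh by (auto intro!: map_idI)
    moreover have "set (map ?h ys) \<subseteq> universe M"
      using that(3) h by (auto simp: bij_betw_def)
    ultimately show ?thesis
      using assms that unfolding iso_between_def by (metis length_map)
  qed
  with h show ?thesis
    by (simp add: iso_between_def)
qed

lemma iso_between_comp:
  assumes f: "iso_between L ar M N f" and h: "iso_between L ar N K h"
  shows "iso_between L ar M K (h \<circ> f)"
proof -
  have "bij_betw (h \<circ> f) (universe M) (universe K)"
    using f h by (auto simp: iso_between_def intro: bij_betw_trans)
  moreover have "xs \<in> rel M R \<longleftrightarrow> map (h \<circ> f) xs \<in> rel K R"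
    if "R \<in> L" "length xs = ar R" "set xs \<subseteq> universe M" for R xs
  proof -
    have "set (map f xs) \<subseteq> universe N"
      using that(3) f by (auto simp: iso_between_def bij_betw_def)
    with that f h have "map f xs \<in> rel N R \<longleftrightarrow> map h (map f xs) \<in> rel K R"
      unfolding iso_between_def by (metis length_map)
    with that f show ?thesis
      by (auto simp: iso_between_def)
  qed
  ultimately show ?thesis
    by (simp add: iso_between_def)
qed

text \<open>
  The point of stage \<open>n\<close> containing the sample that is coded by the coin tosses \<open>w\<close>: when its point
  is split, toss \<open>n\<close> decides whether the sample moves to the new half.
\<close>

primrec pos :: "(nat \<Rightarrow> nat) \<Rightarrow> (nat \<Rightarrow> bool) \<Rightarrow> nat \<Rightarrow> nat" where
  "pos p w 0 = 0"
| "pos p w (Suc n) = (if pos p w n = p n \<and> w n then Suc n else pos p w n)"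

lemma pos_le: "pos p w n \<le> n"
  by (induction n) auto

lemma pos_nonzero_mono:
  assumes "n \<le> n'" "pos p w n \<noteq> 0"
  shows "pos p w n' \<noteq> 0"
  using assms by (induction rule: dec_induct) auto

text \<open>A new point takes samples from one old point only, so samples in different points never
  meet again.\<close>

lemma pos_neq_mono:
  assumes "n \<le> n'" "pos p w n \<noteq> pos p w' n"
  shows "pos p w n' \<noteq> pos p w' n'"
  using assms(1)
proof (induction rule: dec_induct)
  case (step k)
  have "pos p w k \<noteq> Suc k" "pos p w' k \<noteq> Suc k"
    using pos_le[of p w k] pos_le[of p w' k] by auto
  with step.IH show ?case by auto
qed (fact assms)

lemma pos_stable:
  assumes "n \<le> n'" "\<forall>k\<in>{n..<n'}. p k = 0" "pos p w n \<noteq> 0"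
  shows "pos p w n' = pos p w n"
  using assms(1)
proof (induction rule: dec_induct)
  case (step k)
  then have "p k = 0" using assms(2) by auto
  with step assms(3) show ?case by simp
qed simp

text \<open>A relation holds if it holds of the current labels at all late stages, which makes sense
  for every \<open>w\<close>. For generic samples, with \<open>G\<close> acting by automorphisms of
  \<open>M\<close>, the truth value is constant from some stage on, since the labels stay in one
  orbit.\<close>

definition sample_structure ::
  "'r set \<Rightarrow> ('r \<Rightarrow> nat) \<Rightarrow> ('r, nat) relstruct \<Rightarrow> (nat \<Rightarrow> nat) \<Rightarrow> (nat \<Rightarrow> nat) \<Rightarrow>
    (nat \<Rightarrow> nat \<Rightarrow> bool) \<Rightarrow> ('r, nat) relstruct" where
  "sample_structure L ar M m p w = \<lparr>universe = UNIV, rel = (\<lambda>R. {ns. R \<in> L \<and> length ns = ar R \<and>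
     (\<exists>n0. \<forall>n\<ge>n0. map (\<lambda>i. m (pos p (w i) n)) ns \<in> rel M R)})\<rparr>"

lemma sample_structure_in: "sample_structure L ar M m p w \<in> nat_structures L ar"
  by (auto simp: sample_structure_def nat_structures_def is_structure_def)

locale splitting_sequence = trivial_dcl_group +
  fixes m p :: "nat \<Rightarrow> nat"
  assumes inj_m: "inj_on m {1..}"
    and splitting: "splitting m p k"
    and recurrent: "\<exists>k\<ge>n. p k = j"
    and extension: "\<exists>n1\<ge>n. \<exists>n2. extension_at n1 n2 m p as b"

text \<open>Deterministic conditions under which the sampled structure is isomorphic to the original
  one; they are later shown to hold almost surely.\<close>

locale generic_sample = splitting_sequence +
  fixes w :: "nat \<Rightarrow> nat \<Rightarrow> bool"
  assumes distinct_samples: "i \<noteq> j \<Longrightarrow> \<exists>n. pos p (w i) n \<noteq> pos p (w j) n"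
    and nonzero_samples: "\<exists>n. pos p (w i) n \<noteq> 0"
    and dense_samples: "y \<le> n \<Longrightarrow> \<exists>i. pos p (w i) n = y"
begin

section \<open>Orbits of the labels of separated samples\<close>

definition separated :: "nat \<Rightarrow> nat set \<Rightarrow> bool" where
  "separated n I \<longleftrightarrow> inj_on (\<lambda>i. pos p (w i) n) I \<and> (\<forall>i\<in>I. pos p (w i) n \<noteq> 0)"

lemma separated_mono: "separated n I \<Longrightarrow> n \<le> n' \<Longrightarrow> separated n' I"
  unfolding separated_def inj_on_def by (meson pos_neq_mono pos_nonzero_mono)

lemma separated_subset: "separated n I \<Longrightarrow> J \<subseteq> I \<Longrightarrow> separated n J"
  unfolding separated_def by (auto intro: inj_on_subset)

text \<open>Any two distinct samples are apart at all late stages, and each sample has left point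
  \<open>0\<close>; finitely many such conditions hold at a common stage.\<close>

lemma ex_separated:
  assumes "finite I"
  shows "\<exists>n. separated n I"
proof -
  have "\<forall>\<^sub>F n in sequentially. pos p (w i) n = pos p (w j) n \<longrightarrow> i = j" for i j
  proof (cases "i = j")
    case False
    with distinct_samples obtain n where "pos p (w i) n \<noteq> pos p (w j) n" by blast
    then show ?thesis
      unfolding eventually_sequentially using pos_neq_mono by blast
  qed simp
  moreover have "\<forall>\<^sub>F n in sequentially. pos p (w i) n \<noteq> 0" for i
    unfolding eventually_sequentially using nonzero_samples[of i] pos_nonzero_mono by blast
  ultimately have "\<forall>\<^sub>F n in sequentially. (\<forall>i\<in>I. \<forall>j\<in>I. pos p (w i) n = pos p (w j) n \<longrightarrow> i = j) \<and>
      (\<forall>i\<in>I. pos p (w i) n \<noteq> 0)"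
    using assms by (intro eventually_conj eventually_ball_finite ballI) auto
  then show ?thesis
    unfolding separated_def inj_on_def eventually_sequentially by blast
qed

definition realized :: "nat \<Rightarrow> (nat \<times> nat) list \<Rightarrow> bool" where
  "realized n zs \<longleftrightarrow> (\<exists>g\<in>G. \<forall>z\<in>set zs. g (m (pos p (w (fst z)) n)) = snd z)"

text \<open>Separated samples occupy distinct nonzero points, so at most one of them moves in a
  split, and the \<open>g\<close> of that split fixes the labels of all the others.\<close>

lemma step_orbit:
  assumes "separated n I"
  shows "\<exists>g\<in>G. \<forall>i\<in>I. g (m (pos p (w i) n)) = m (pos p (w i) (Suc n))"
proof (cases "\<exists>i\<in>I. pos p (w i) n = p n \<and> w i n")
  case False
  then show ?thesis
    by (intro bexI[of _ id] id_mem) auto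
next
  case True
  then obtain i where i: "i \<in> I" "pos p (w i) n = p n" "w i n" by blast
  have "p n \<noteq> 0"
    using assms i by (auto simp: separated_def)
  with splitting[of n] obtain g where g: "g \<in> G"
    "\<forall>l\<in>{1..n} - {p n}. g (m l) = m l" "g (m (p n)) = m (Suc n)"
    by (auto simp: splitting_def)
  have "g (m (pos p (w j) n)) = m (pos p (w j) (Suc n))" if "j \<in> I" for j
  proof (cases "j = i")
    case True
    with i g show ?thesis by simp
  next
    case False
    then have "pos p (w j) n \<noteq> p n"
      using assms i that inj_on_eq_iff[of "\<lambda>i. pos p (w i) n" I j i] by (auto simp: separated_def)
    moreover have "pos p (w j) n \<in> {1..n}"
      using assms that pos_le[of p "w j" n] by (auto simp: separated_def Suc_le_eq)
    ultimately show ?thesis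
      using g(2) by auto
  qed
  with g(1) show ?thesis by blast
qed

lemma realized_Suc:
  assumes "separated n (fst ` set zs)"
  shows "realized (Suc n) zs \<longleftrightarrow> realized n zs"
proof -
  from step_orbit[OF assms] obtain g where g: "g \<in> G"
    "\<And>z. z \<in> set zs \<Longrightarrow> g (m (pos p (w (fst z)) n)) = m (pos p (w (fst z)) (Suc n))"
    by auto
  have inv_g: "inv g (m (pos p (w (fst z)) (Suc n))) = m (pos p (w (fst z)) n)" if "z \<in> set zs" for z
    using g(2)[OF that] bij[OF g(1)] by (metis bij_is_inj inv_f_f)
  show ?thesis
  proof
    assume "realized (Suc n) zs"
    then obtain h where h: "h \<in> G" "\<And>z. z \<in> set zs \<Longrightarrow> h (m (pos p (w (fst z)) (Suc n))) = snd z"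
      by (auto simp: realized_def)
    then have "(h \<circ> g) (m (pos p (w (fst z)) n)) = snd z" if "z \<in> set zs" for z
      using g(2)[OF that] that by (simp del: pos.simps)
    then show "realized n zs"
      unfolding realized_def using comp_mem[OF h(1) g(1)] by blast
  next
    assume "realized n zs"
    then obtain h where h: "h \<in> G" "\<And>z. z \<in> set zs \<Longrightarrow> h (m (pos p (w (fst z)) n)) = snd z"
      by (auto simp: realized_def)
    then have "(h \<circ> inv g) (m (pos p (w (fst z)) (Suc n))) = snd z" if "z \<in> set zs" for z
      using inv_g[OF that] that by (simp del: pos.simps)
    then show "realized (Suc n) zs"
      unfolding realized_def using comp_mem[OF h(1) inv_mem[OF g(1)]] by blast
  qed
qed

lemma realized_iff:
  assumes "separated n (fst ` set zs)" "n \<le> n'"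
  shows "realized n' zs \<longleftrightarrow> realized n zs"
  using assms(2)
proof (induction rule: dec_induct)
  case (step k)
  with realized_Suc[OF separated_mono[OF assms(1)]] show ?case by simp
qed simp

text \<open>The finite partial map from samples to elements is induced by \<open>G\<close> from the
  labels at every separating stage; by \<open>matchedI\<close> one such stage is enough.\<close>

definition matched :: "(nat \<times> nat) list \<Rightarrow> bool" where
  "matched zs \<longleftrightarrow> (\<forall>n. separated n (fst ` set zs) \<longrightarrow> realized n zs)"

lemma matchedI:
  assumes "separated n (fst ` set zs)" "realized n zs"
  shows "matched zs"
  unfolding matched_def
proof (intro allI impI)
  fix n' assume "separated n' (fst ` set zs)"
  from realized_iff[OF this, of "max n n'"] realized_iff[OF assms(1), of "max n n'"] assms(2)
  show "realized n' zs" by simp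
qed

lemma matched_forward:
  assumes "matched zs"
  shows "\<exists>y. matched (zs @ [(x, y)])"
proof -
  obtain n where n: "separated n (insert x (fst ` set zs))"
    using ex_separated[of "insert x (fst ` set zs)"] by auto
  then have "separated n (fst ` set zs)"
    by (rule separated_subset) auto
  with assms obtain g where g: "g \<in> G" "\<forall>z\<in>set zs. g (m (pos p (w (fst z)) n)) = snd z"
    by (auto simp: matched_def realized_def)
  then have "realized n (zs @ [(x, g (m (pos p (w x) n)))])"
    by (auto simp: realized_def)
  moreover have "separated n (fst ` set (zs @ [(x, g (m (pos p (w x) n)))]))"
    using n by simp
  ultimately show ?thesis
    using matchedI by blast
qed

text \<open>At a suitable late stage the type of \<open>b\<close> over the matched elements is
  realized by a point \<open>y\<close>, and by density some sample lies in \<open>y\<close>.\<close>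

lemma matched_backward:
  assumes "matched zs" and b: "b \<notin> snd ` set zs"
  shows "\<exists>x. matched (zs @ [(x, b)])"
proof -
  let ?I = "fst ` set zs"
  obtain n0 where n0: "separated n0 ?I"
    using ex_separated[of ?I] by auto
  obtain n1 n2 where n1: "n1 \<ge> n0" and ext: "extension_at n1 n2 m p (map snd zs) b"
    using extension by blast
  define s where "s = map (\<lambda>z. pos p (w (fst z)) n1) zs"
  have sep1: "separated n1 ?I"
    using n0 n1 by (rule separated_mono)
  have le: "n1 \<le> n2"
    using ext by (simp add: extension_at_def)
  \<comment> \<open>Between \<open>n1\<close> and \<open>n2\<close> only point \<open>0\<close> is
    split, so the matched samples stay at the points listed in \<open>s\<close>.\<close>
  have stable: "pos p (w i) n2 = pos p (w i) n1" if "i \<in> ?I" for i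
    using ext that sep1 by (intro pos_stable) (auto simp: extension_at_def separated_def)
  have "set s \<subseteq> {1..n1}"
    using sep1 pos_le by (auto simp: s_def separated_def Suc_le_eq)
  then have "realizes n2 m (map snd zs) b s"
    using ext by (simp add: extension_at_def)
  moreover have "\<exists>g\<in>G. map (g \<circ> m) s = map snd zs"
    using assms(1) sep1 by (auto simp: matched_def realized_def s_def)
  ultimately obtain y g where y: "y \<in> {1..n2}" and g: "g \<in> G" "map (g \<circ> m) s = map snd zs" "g (m y) = b"
    unfolding realizes_def by blast
  obtain x where x: "pos p (w x) n2 = y"
    using dense_samples[of y n2] y by auto
  have gz: "g (m (pos p (w (fst z)) n2)) = snd z" if "z \<in> set zs" for z
    using g(2) that stable by (auto simp: s_def)
  \<comment> \<open>A matched sample in \<open>y\<close> would be matched with \<open>b\<close>,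
    which lies outside the range; hence \<open>x\<close> is separated from the matched
    samples.\<close>
  have "y \<notin> (\<lambda>i. pos p (w i) n2) ` ?I"
  proof
    assume "y \<in> (\<lambda>i. pos p (w i) n2) ` ?I"
    then obtain z where "z \<in> set zs" "y = pos p (w (fst z)) n2" by auto
    with gz g(3) b show False by force
  qed
  then have "separated n2 (insert x ?I)"
    using separated_mono[OF sep1 le] x y by (auto simp: separated_def)
  moreover have "realized n2 (zs @ [(x, b)])"
    unfolding realized_def using gz g x by (intro bexI[of _ g]) auto
  ultimately show ?thesis
    using matchedI[of n2 "zs @ [(x, b)]"] by auto
qed

lemma matched_inj:
  assumes "matched zs" "z \<in> set zs" "z' \<in> set zs"
  shows "fst z = fst z' \<longleftrightarrow> snd z = snd z'"
proof -
  obtain n where n: "separated n (fst ` set zs)"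
    using ex_separated[of "fst ` set zs"] by auto
  with assms(1) obtain g where g: "g \<in> G" "\<forall>z\<in>set zs. g (m (pos p (w (fst z)) n)) = snd z"
    by (auto simp: matched_def realized_def)
  let ?q = "\<lambda>z. pos p (w (fst z)) n"
  have "fst z = fst z' \<longleftrightarrow> ?q z = ?q z'"
    using n assms inj_on_eq_iff[of "\<lambda>i. pos p (w i) n" "fst ` set zs" "fst z" "fst z'"]
    by (auto simp: separated_def)
  also have "\<dots> \<longleftrightarrow> m (?q z) = m (?q z')"
    using n assms inj_on_eq_iff[OF inj_m, of "?q z" "?q z'"] by (auto simp: separated_def Suc_le_eq)
  also have "\<dots> \<longleftrightarrow> snd z = snd z'"
    using g assms bij[OF g(1)] by (metis bij_is_inj inj_eq)
  finally show ?thesis .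
qed

text \<open>Back-and-forth gives a permutation \<open>f\<close> from samples to elements. On
  finitely many samples \<open>f\<close> is, at each late stage, the labelling followed by an
  element of \<open>G\<close>, so the relations agree.\<close>

lemma sample_structure_isomorphic:
  assumes M: "M \<in> nat_structures L ar"
    and aut: "\<And>g R xs. g \<in> G \<Longrightarrow> R \<in> L \<Longrightarrow> map g xs \<in> rel M R \<longleftrightarrow> xs \<in> rel M R"
  shows "isomorphic L ar M (sample_structure L ar M m p w)"
proof -
  obtain f where f: "bij f" and
    matched_f: "\<And>A. finite A \<Longrightarrow> \<exists>zs. matched zs \<and> A \<subseteq> fst ` set zs \<and> (\<forall>z\<in>set zs. snd z = f (fst z))"
  proof (rule back_and_forth[of matched])
    show "matched []"
      using id_mem by (auto simp: matched_def realized_def)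
  qed (use matched_forward matched_backward matched_inj in auto)
  let ?N = "sample_structure L ar M m p w"
  have "xs \<in> rel ?N R \<longleftrightarrow> map f xs \<in> rel M R" if R: "R \<in> L" "length xs = ar R" for R xs
  proof -
    obtain zs where zs: "matched zs" "set xs \<subseteq> fst ` set zs" "\<forall>z\<in>set zs. snd z = f (fst z)"
      using matched_f[of "set xs"] by auto
    obtain n0 where n0: "separated n0 (fst ` set zs)"
      using ex_separated[of "fst ` set zs"] by auto
    have "map (\<lambda>i. m (pos p (w i) n)) xs \<in> rel M R \<longleftrightarrow> map f xs \<in> rel M R" if "n \<ge> n0" for n
    proof -
      from zs(1) separated_mono[OF n0 that] obtain g where g: "g \<in> G"
        "\<forall>z\<in>set zs. g (m (pos p (w (fst z)) n)) = snd z"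
        by (auto simp: matched_def realized_def)
      with zs(2,3) have "map g (map (\<lambda>i. m (pos p (w i) n)) xs) = map f xs"
        by fastforce
      with aut[OF g(1) R(1)] show ?thesis by metis
    qed
    then have "(\<exists>n1. \<forall>n\<ge>n1. map (\<lambda>i. m (pos p (w i) n)) xs \<in> rel M R) \<longleftrightarrow> map f xs \<in> rel M R"
      by (meson max.cobounded1 max.cobounded2)
    with R show ?thesis
      by (simp add: sample_structure_def)
  qed
  then have "iso_between L ar ?N M f"
    using f M by (auto simp: iso_between_def nat_structures_def sample_structure_def)
  then show ?thesis
    by (auto simp: isomorphic_def dest: iso_between_inv_into)
qed

end

section \<open>Random samples\<close>

definition coin :: "bool measure" where
  "coin = measure_pmf (pmf_of_set UNIV)"

definition tosses :: "(nat \<Rightarrow> bool) measure" where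
  "tosses = Pi\<^sub>M UNIV (\<lambda>_. coin)"

definition samples :: "(nat \<Rightarrow> nat \<Rightarrow> bool) measure" where
  "samples = Pi\<^sub>M UNIV (\<lambda>_. tosses)"

lemma space_coin [simp]: "space coin = UNIV"
  and sets_coin [simp, measurable_cong]: "sets coin = sets (count_space UNIV)"
  by (simp_all add: coin_def)

lemma prob_space_coin: "prob_space coin"
  by (simp add: coin_def measure_pmf.prob_space_axioms)

lemma emeasure_coin_Not: "emeasure coin (Not -` A) = emeasure coin A"
proof -
  have "bij Not" by (rule involuntory_imp_bij) simp
  then have "map_pmf Not (pmf_of_set UNIV) = pmf_of_set UNIV"
    by (intro map_pmf_of_set_bij_betw) auto
  then have "emeasure coin A = emeasure (measure_pmf (map_pmf Not (pmf_of_set UNIV))) A"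
    by (simp add: coin_def)
  then show ?thesis
    by (simp add: coin_def)
qed

lemma product_prob_space_coin: "product_prob_space (\<lambda>_::nat. coin)"
  using prob_space_coin
  by (simp add: product_prob_space_def product_prob_space_axioms_def product_sigma_finite_def
      prob_space_imp_sigma_finite)

lemma space_tosses [simp]: "space tosses = UNIV"
  by (simp add: tosses_def space_PiM)

lemma measurable_toss [measurable]: "(\<lambda>w. w n) \<in> tosses \<rightarrow>\<^sub>M count_space UNIV"
proof -
  have "(\<lambda>w. w n) \<in> tosses \<rightarrow>\<^sub>M coin"
    unfolding tosses_def by simp
  also have "tosses \<rightarrow>\<^sub>M coin = tosses \<rightarrow>\<^sub>M count_space UNIV"
    by (intro measurable_cong_sets) auto
  finally show ?thesis .
qed

interpretation tosses: prob_space tosses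
  unfolding tosses_def by (intro prob_space_PiM prob_space_coin)

lemma product_prob_space_tosses: "product_prob_space (\<lambda>_::nat. tosses)"
  by (simp add: product_prob_space_def product_prob_space_axioms_def product_sigma_finite_def
      prob_space_imp_sigma_finite tosses.prob_space_axioms)

lemma space_samples [simp]: "space samples = UNIV"
  by (simp add: samples_def space_PiM)

lemma measurable_sample [measurable]: "(\<lambda>w. w i) \<in> samples \<rightarrow>\<^sub>M tosses"
  unfolding samples_def by simp

interpretation samples: prob_space samples
  unfolding samples_def by (intro prob_space_PiM tosses.prob_space_axioms)

lemma measurable_flip: "(\<lambda>w. w(n := \<not> w n)) \<in> tosses \<rightarrow>\<^sub>M tosses"
proof -
  have "(\<lambda>w. \<not> w n) \<in> tosses \<rightarrow>\<^sub>M count_space UNIV"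
    by measurable
  also have "tosses \<rightarrow>\<^sub>M count_space UNIV = tosses \<rightarrow>\<^sub>M coin"
    by (intro measurable_cong_sets) auto
  finally show ?thesis
    unfolding tosses_def by (intro measurable_fun_upd[where J=UNIV]) auto
qed

text \<open>On cylinders, the flip replaces one factor by its preimage under negation, which has the
  same measure for a fair coin.\<close>

lemma distr_tosses_flip: "distr tosses tosses (\<lambda>w. w(n := \<not> w n)) = tosses"
proof -
  interpret C: product_prob_space "\<lambda>_::nat. coin" UNIV
    by (rule product_prob_space_coin)
  note measurable_flip [measurable]
  show ?thesis
    unfolding tosses_def
  proof (rule C.PiM_eq)
    fix J :: "nat set" and F :: "nat \<Rightarrow> bool set"
    assume J: "finite J"
    let ?F = "\<lambda>j. if j = n then Not -` F j else F j"
    have "(\<lambda>w. w(n := \<not> w n)) -` prod_emb UNIV (\<lambda>_. coin) J (Pi\<^sub>E J F) =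
        prod_emb UNIV (\<lambda>_. coin) J (Pi\<^sub>E J ?F)"
      by (auto simp: prod_emb_def PiE_iff split: if_splits)
    moreover have "prod_emb UNIV (\<lambda>_. coin) J (Pi\<^sub>E J F) \<in> sets (Pi\<^sub>M UNIV (\<lambda>_. coin))"
      using J by (intro sets_PiM_I) auto
    ultimately have "emeasure (distr tosses tosses (\<lambda>w. w(n := \<not> w n)))
        (prod_emb UNIV (\<lambda>_. coin) J (Pi\<^sub>E J F)) = emeasure tosses (prod_emb UNIV (\<lambda>_. coin) J (Pi\<^sub>E J ?F))"
      by (subst emeasure_distr) (simp_all add: tosses_def[symmetric])
    also have "\<dots> = (\<Prod>j\<in>J. emeasure coin (?F j))"
      unfolding tosses_def using J by (intro C.emeasure_PiM_emb) auto
    also have "\<dots> = (\<Prod>j\<in>J. emeasure coin (F j))"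
      by (intro prod.cong) (auto simp: emeasure_coin_Not)
    finally show "emeasure (distr (Pi\<^sub>M UNIV (\<lambda>_. coin)) (Pi\<^sub>M UNIV (\<lambda>_. coin)) (\<lambda>w. w(n := \<not> w n)))
        (prod_emb UNIV (\<lambda>_. coin) J (Pi\<^sub>E J F)) = (\<Prod>j\<in>J. emeasure coin (F j))"
      by (simp add: tosses_def)
  qed simp
qed

section \<open>Weights of points under fair coin tosses\<close>

lemma measurable_pos [measurable]: "(\<lambda>w. pos p w n) \<in> tosses \<rightarrow>\<^sub>M count_space UNIV"
proof (induction n)
  case (Suc n)
  note Suc.IH [measurable]
  show ?case by simp
qed simp

lemma measurable_pos_sample [measurable]: "(\<lambda>w. pos p (w i) n) \<in> samples \<rightarrow>\<^sub>M count_space UNIV"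
  by (rule measurable_compose[OF measurable_sample measurable_pos])

definition weight :: "(nat \<Rightarrow> nat) \<Rightarrow> nat \<Rightarrow> nat \<Rightarrow> real" where
  "weight p n j = measure tosses {w. pos p w n = j}"

lemma pos_flip: "k \<le> n \<Longrightarrow> pos p (w(n := b)) k = pos p w k"
  by (induction k) auto

lemma sets_tosses_Collect: "Measurable.pred tosses P \<Longrightarrow> {w. P w} \<in> sets tosses"
  by (simp add: pred_def)

text \<open>The position at stage \<open>n\<close> depends only on the tosses before
  \<open>n\<close>, so flipping toss \<open>n\<close> exchanges the two sets and preserves the
  measure.\<close>

lemma weight_half:
  "measure tosses {w. pos p w n = j \<and> w n} = weight p n j / 2"
  "measure tosses {w. pos p w n = j \<and> \<not> w n} = weight p n j / 2"
proof -
  let ?A = "{w. pos p w n = j \<and> w n}" and ?B = "{w. pos p w n = j \<and> \<not> w n}"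
  have sets: "?A \<in> sets tosses" "?B \<in> sets tosses"
    by (intro sets_tosses_Collect; measurable)+
  have "(\<lambda>w. w(n := \<not> w n)) -` ?A = ?B"
    by (auto simp: pos_flip)
  then have eq: "measure tosses ?A = measure tosses ?B"
    using measure_distr[OF measurable_flip sets(1), of n] distr_tosses_flip[of n]
    by simp
  have "{w. pos p w n = j} = ?A \<union> ?B" by auto
  then have "weight p n j = measure tosses ?A + measure tosses ?B"
    unfolding weight_def using sets by (subst tosses.finite_measure_Union[symmetric]) auto
  with eq show "measure tosses ?A = weight p n j / 2" "measure tosses ?B = weight p n j / 2"
    by simp_all
qed

lemma weight_Suc_new: "weight p (Suc n) (Suc n) = weight p n (p n) / 2"
proof -
  have "pos p w n \<noteq> Suc n" for w
    using pos_le[of p w n] by auto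
  then have "{w. pos p w (Suc n) = Suc n} = {w. pos p w n = p n \<and> w n}"
    by auto
  then show ?thesis
    using weight_half(1)[of p n "p n"] by (simp add: weight_def)
qed

lemma weight_Suc_old:
  assumes "j \<le> n"
  shows "weight p (Suc n) j = (if p n = j then weight p n j / 2 else weight p n j)"
proof -
  have "{w. pos p w (Suc n) = j} =
      (if p n = j then {w. pos p w n = j \<and> \<not> w n} else {w. pos p w n = j})"
    using assms by auto
  then show ?thesis
    using weight_half(2)[of p n j] by (simp add: weight_def)
qed

lemma weight_nonneg: "weight p n j \<ge> 0"
  by (simp add: weight_def)

lemma weight_le_1: "weight p n j \<le> 1"
  by (simp add: weight_def)

lemma weight_pos:
  assumes "\<And>k. p k \<le> k" "j \<le> n"
  shows "weight p n j > 0"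
  using assms(2)
proof (induction n arbitrary: j)
  case 0
  then show ?case
    using tosses.prob_space by (simp add: weight_def)
next
  case (Suc n)
  show ?case
  proof (cases "j = Suc n")
    case True
    with Suc.IH[OF assms(1)] show ?thesis by (simp add: weight_Suc_new)
  next
    case False
    with Suc show ?thesis by (simp add: weight_Suc_old)
  qed
qed

text \<open>A new point receives half the weight of its parent, which is at most \<open>c\<close>;
  an old point drops to \<open>c / 2\<close> once it is split. The second bound uses the first for
  the parent, so both are proved in one induction.\<close>

lemma weight_halved:
  assumes "\<And>k. p k \<le> k" "n \<le> n'" "\<And>j. j \<le> n \<Longrightarrow> weight p n j \<le> c" "j \<le> n'"
  shows "weight p n' j \<le> c"
    and "n < j \<or> (\<exists>k. n \<le> k \<and> k < n' \<and> p k = j) \<Longrightarrow> weight p n' j \<le> c / 2"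
  using assms(2,4)
proof (induction n' arbitrary: j rule: dec_induct)
  case base
  {
    case 1
    then show ?case using assms(3) by simp
  next
    case 2
    then show ?case by auto
  }
next
  case (step n')
  have c: "0 \<le> c"
    using weight_nonneg[of p n 0] assms(3)[of 0] by simp
  have new: "weight p (Suc n') (Suc n') \<le> c / 2"
    using step.IH(1)[of "p n'"] assms(1)[of n'] by (simp add: weight_Suc_new)
  have old: "weight p (Suc n') j \<le> weight p n' j" if "j \<le> n'" for j
    using weight_nonneg[of p n' j] by (simp add: weight_Suc_old[OF that])
  {
    case 1
    then show ?case
      using new old[of j] step.IH(1)[of j] c by (cases "j = Suc n'") auto
  next
    case 2
    show ?case
    proof (cases "j = Suc n'")
      case False
      then have j: "j \<le> n'" using 2 by simp
      show ?thesis
      proof (cases "p n' = j")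
        case True
        then show ?thesis
          using step.IH(1)[OF j] by (simp add: weight_Suc_old[OF j])
      next
        case False
        with 2(1) have "n < j \<or> (\<exists>k. n \<le> k \<and> k < n' \<and> p k = j)"
          by (auto simp: less_Suc_eq)
        from step.IH(2)[OF this j] old[OF j] show ?thesis by simp
      qed
    qed (use new in simp)
  }
qed

lemma weight_uniformly_small:
  assumes "\<And>k. p k \<le> k" "\<And>j n. \<exists>k\<ge>n. p k = j"
  shows "\<exists>n. \<forall>j\<le>n. weight p n j \<le> (1 / 2) ^ r"
proof (induction r)
  case 0
  show ?case by (simp add: weight_le_1)
next
  case (Suc r)
  then obtain n where n: "\<And>j. j \<le> n \<Longrightarrow> weight p n j \<le> (1 / 2) ^ r" by blast
  obtain k where k: "\<And>j. k j \<ge> n \<and> p (k j) = j"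
    using assms(2) by metis
  \<comment> \<open>By stage \<open>n'\<close> each of the points up to \<open>n\<close> has been
    split at least once since stage \<open>n\<close>.\<close>
  define n' where "n' = Suc (Max (k ` {..n}))"
  have k_less: "k j < n'" if "j \<le> n" for j
    using that by (simp add: n'_def less_Suc_eq_le)
  have "n \<le> n'"
    using k[of 0] k_less[of 0] by simp
  moreover have "n < j \<or> (\<exists>i. n \<le> i \<and> i < n' \<and> p i = j)" for j
    using k[of j] k_less[of j] by (cases "j \<le> n") auto
  ultimately have "weight p n' j \<le> (1 / 2) ^ r / 2" if "j \<le> n'" for j
    using weight_halved(2)[OF assms(1) _ n] that by blast
  then show ?case by auto
qed

text \<open>The event that \<open>Q n\<close> holds for all \<open>n\<close> has probability at most
  \<open>c ^ r\<close> for every \<open>r\<close>, hence is null.\<close>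

lemma (in prob_space) AE_ex_not_if_small:
  fixes Q :: "nat \<Rightarrow> 'a \<Rightarrow> bool"
  assumes [measurable]: "\<And>n. Measurable.pred M (Q n)"
    and small: "\<And>r. \<exists>n. prob {x \<in> space M. Q n x} \<le> c ^ r" and c: "0 \<le> c" "c < 1"
  shows "AE x in M. \<exists>n. \<not> Q n x"
proof -
  have "prob {x \<in> space M. \<forall>n. Q n x} \<le> c ^ r" for r
  proof -
    obtain n where n: "prob {x \<in> space M. Q n x} \<le> c ^ r"
      using small by blast
    have "prob {x \<in> space M. \<forall>n. Q n x} \<le> prob {x \<in> space M. Q n x}"
      by (intro finite_measure_mono) auto
    with n show ?thesis by simp
  qed
  moreover have "(\<lambda>r. c ^ r) \<longlonglongrightarrow> 0"
    using c by (intro LIMSEQ_power_zero) simp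
  ultimately have "prob {x \<in> space M. \<forall>n. Q n x} \<le> 0"
    by (intro LIMSEQ_le_const) auto
  then have "prob {x \<in> space M. \<forall>n. Q n x} = 0"
    using measure_nonneg by (metis order_antisym)
  then have "AE x in M. \<not> (\<forall>n. Q n x)"
    by (subst (asm) prob_Collect_eq_0) auto
  then show ?thesis by simp
qed

lemma measure_samples_Collect:
  assumes "finite J" "\<And>i. i \<in> J \<Longrightarrow> A i \<in> sets tosses"
  shows "measure samples {w. \<forall>i\<in>J. w i \<in> A i} = (\<Prod>i\<in>J. measure tosses (A i))"
proof -
  interpret T: product_prob_space "\<lambda>_::nat. tosses" UNIV
    by (rule product_prob_space_tosses)
  have "emeasure samples {w. \<forall>i\<in>J. w i \<in> A i} = (\<Prod>i\<in>J. emeasure tosses (A i))"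
    using T.emeasure_PiM_Collect[of J A] assms by (simp add: samples_def[symmetric])
  then show ?thesis
    by (simp add: samples.emeasure_eq_measure tosses.emeasure_eq_measure prod_ennreal prod_nonneg)
qed

section \<open>Independent samples are almost surely generic\<close>

context splitting_sequence
begin

lemma p_le: "p k \<le> k"
  using splitting by (simp add: splitting_def)

text \<open>Point \<open>0\<close> becomes arbitrarily light like all others, so no mass remains
  unassigned in the limit.\<close>

lemma AE_nonzero_sample: "AE w in samples. \<exists>n. pos p (w i) n \<noteq> 0"
proof -
  have "\<exists>n. measure tosses {w \<in> space tosses. pos p w n = 0} \<le> (1 / 2) ^ r" for r
    using weight_uniformly_small[OF p_le recurrent, of r] by (auto simp: weight_def)
  then have "AE w in tosses. \<exists>n. pos p w n \<noteq> 0"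
    by (intro tosses.AE_ex_not_if_small[where c="1/2"]) auto
  then show ?thesis
    unfolding samples_def by (intro AE_PiM_component tosses.prob_space_axioms) auto
qed

text \<open>By independence two samples share a point with probability at most the sum of the
  squared weights. This is at most the largest weight, because the weights add up to at most
  1.\<close>

lemma AE_distinct_samples:
  assumes "i \<noteq> j"
  shows "AE w in samples. \<exists>n. pos p (w i) n \<noteq> pos p (w j) n"
proof -
  have "\<exists>n. measure samples {w \<in> space samples. pos p (w i) n = pos p (w j) n} \<le> (1 / 2) ^ r" for r
  proof -
    obtain n where n: "\<And>y. y \<le> n \<Longrightarrow> weight p n y \<le> (1 / 2) ^ r"
      using weight_uniformly_small[OF p_le recurrent, of r] by blast
    let ?E = "\<lambda>y. {w. \<forall>l\<in>{i, j}. w l \<in> {v. pos p v n = y}}"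
    have "?E y \<in> sets samples" for y
    proof -
      have "Measurable.pred samples (\<lambda>w. pos p (w i) n = y \<and> pos p (w j) n = y)"
        by measurable
      then show ?thesis by (simp add: pred_def)
    qed
    then have E: "?E ` {..n} \<subseteq> sets samples" by blast
    have "{w \<in> space samples. pos p (w i) n = pos p (w j) n} \<subseteq> (\<Union>y\<in>{..n}. ?E y)"
      using pos_le by fastforce
    then have "measure samples {w \<in> space samples. pos p (w i) n = pos p (w j) n} \<le>
        measure samples (\<Union>y\<in>{..n}. ?E y)"
      using E by (intro samples.finite_measure_mono sets.finite_UN) auto
    also have "\<dots> \<le> (\<Sum>y\<le>n. measure samples (?E y))"
      by (intro samples.finite_measure_subadditive_finite E) simp
    also have "\<dots> = (\<Sum>y\<le>n. weight p n y * weight p n y)"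
    proof (intro sum.cong refl)
      fix y
      have "measure samples (?E y) = (\<Prod>l\<in>{i, j}. measure tosses {v. pos p v n = y})"
        by (intro measure_samples_Collect sets_tosses_Collect) simp_all
      with assms show "measure samples (?E y) = weight p n y * weight p n y"
        by (simp add: weight_def)
    qed
    also have "\<dots> \<le> (\<Sum>y\<le>n. (1 / 2) ^ r * weight p n y)"
      by (intro sum_mono mult_right_mono n weight_nonneg) simp
    also have "\<dots> = (1 / 2) ^ r * (\<Sum>y\<le>n. weight p n y)"
      by (simp add: sum_distrib_left)
    also have "(\<Sum>y\<le>n. weight p n y) = measure tosses (\<Union>y\<in>{..n}. {w. pos p w n = y})"
      unfolding weight_def
      by (intro tosses.finite_measure_finite_Union[symmetric])
        (auto simp: disjoint_family_on_def intro!: sets_tosses_Collect)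
    also have "(1 / 2) ^ r * \<dots> \<le> (1 / 2) ^ r * 1"
      by (intro mult_left_mono tosses.prob_le_1) simp
    finally show ?thesis by auto
  qed
  then show ?thesis
    by (intro samples.AE_ex_not_if_small[where c="1/2"]) auto
qed

text \<open>Each of \<open>r\<close> independent samples misses \<open>y\<close> with probability
  \<open>1 - weight p n y\<close>, which is below 1 as every existing point has positive
  weight.\<close>

lemma AE_dense_samples:
  assumes "y \<le> n"
  shows "AE w in samples. \<exists>i. pos p (w i) n = y"
proof -
  have "AE w in samples. \<exists>k. \<not> (\<forall>i\<in>{..<k}. pos p (w i) n \<noteq> y)"
  proof (rule samples.AE_ex_not_if_small)
    show "\<exists>k. measure samples {w \<in> space samples. \<forall>i\<in>{..<k}. pos p (w i) n \<noteq> y} \<le>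
        (1 - weight p n y) ^ r" for r
    proof -
      have "measure samples {w. \<forall>i\<in>{..<r}. w i \<in> {v. pos p v n \<noteq> y}} =
          (\<Prod>i<r. measure tosses {v. pos p v n \<noteq> y})"
        by (intro measure_samples_Collect sets_tosses_Collect) simp_all
      also have "measure tosses {v. pos p v n \<noteq> y} = 1 - weight p n y"
      proof -
        have "{v. pos p v n \<noteq> y} = space tosses - {v. pos p v n = y}" by auto
        then show ?thesis
          unfolding weight_def by (simp add: tosses.prob_compl sets_tosses_Collect del: space_tosses)
      qed
      finally show ?thesis by (intro exI[of _ r]) simp
    qed
    show "0 \<le> 1 - weight p n y" "1 - weight p n y < 1"
      using weight_le_1[of p n y] weight_pos[of p y n, OF p_le assms] by auto
  qed measurable
  then show ?thesis
    by eventually_elim auto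
qed

lemma AE_generic_sample: "AE w in samples. generic_sample G m p w"
proof -
  have "AE w in samples. \<forall>i j. i \<noteq> j \<longrightarrow> (\<exists>n. pos p (w i) n \<noteq> pos p (w j) n)"
    using AE_distinct_samples by (auto simp: AE_all_countable)
  moreover have "AE w in samples. \<forall>i. \<exists>n. pos p (w i) n \<noteq> 0"
    using AE_nonzero_sample by (auto simp: AE_all_countable)
  moreover have "AE w in samples. \<forall>n y. y \<le> n \<longrightarrow> (\<exists>i. pos p (w i) n = y)"
    using AE_dense_samples by (auto simp: AE_all_countable)
  ultimately show ?thesis
    by eventually_elim
      (use splitting_sequence_axioms in \<open>auto simp: generic_sample_def generic_sample_axioms_def\<close>)
qed

end

section \<open>The invariant measure\<close>

lemma measurable_structure_space:
  assumes "\<And>x. x \<in> space N \<Longrightarrow> f x \<in> nat_structures L ar"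
    and "\<And>R ns. R \<in> L \<Longrightarrow> length ns = ar R \<Longrightarrow> Measurable.pred N (\<lambda>x. ns \<in> rel (f x) R)"
  shows "f \<in> N \<rightarrow>\<^sub>M structure_space L ar"
proof (rule measurable_sigma_sets[OF sets_structure_space])
  fix A assume "A \<in> {{N \<in> nat_structures L ar. ns \<in> rel N R} | R ns. R \<in> L \<and> length ns = ar R}"
  then obtain R ns where A: "A = {N \<in> nat_structures L ar. ns \<in> rel N R}" "R \<in> L" "length ns = ar R"
    by blast
  have "f -` A \<inter> space N = {x \<in> space N. ns \<in> rel (f x) R}"
    using assms(1) by (auto simp: A(1))
  with assms(2)[OF A(2,3)] show "f -` A \<inter> space N \<in> sets N"
    by (simp add: pred_def)
qed (use assms(1) in auto)

lemma measurable_sample_structure: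
  "sample_structure L ar M m p \<in> samples \<rightarrow>\<^sub>M structure_space L ar"
proof (rule measurable_structure_space)
  fix R and ns :: "nat list"
  have [measurable]: "(\<lambda>w. map (\<lambda>i. m (pos p (w i) n)) ns) \<in> samples \<rightarrow>\<^sub>M count_space UNIV" for n
  proof (induction ns)
    case (Cons i ns)
    note Cons.IH [measurable]
    have "(\<lambda>w. m (pos p (w i) n) # map (\<lambda>i. m (pos p (w i) n)) ns) \<in> samples \<rightarrow>\<^sub>M count_space UNIV"
      by (rule measurable_compose_countable[where f="\<lambda>x w. x # map (\<lambda>i. m (pos p (w i) n)) ns"])
        measurable
    then show ?case by simp
  qed simp
  show "Measurable.pred samples (\<lambda>w. ns \<in> rel (sample_structure L ar M m p w) R)"
    by (simp add: sample_structure_def)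
qed (rule sample_structure_in)

lemma mem_rel_logic_action:
  assumes "bij g"
  shows "ns \<in> rel (logic_action g N) R \<longleftrightarrow> map (inv g) ns \<in> rel N R"
proof -
  have "map g (map (inv g) ns) = ns"
    using assms by (auto intro!: map_idI simp: bij_is_surj surj_f_inv_f)
  then show ?thesis
    using map_mem_rel_logic_action[OF assms, of "map (inv g) ns"] by simp
qed

lemma measurable_logic_action:
  assumes "bij g"
  shows "logic_action g \<in> structure_space L ar \<rightarrow>\<^sub>M structure_space L ar"
proof (rule measurable_structure_space)
  show "logic_action g N \<in> nat_structures L ar" if "N \<in> space (structure_space L ar)" for N
    using that assms by (simp add: space_structure_space logic_action_in_nat_structures)
  show "Measurable.pred (structure_space L ar) (\<lambda>N. ns \<in> rel (logic_action g N) R)" if "R \<in> L" for R ns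
    using pred_rel[OF that] by (simp add: mem_rel_logic_action[OF assms])
qed

lemma logic_action_inv:
  assumes "bij g"
  shows "logic_action (inv g) (logic_action g N) = N" "logic_action g (logic_action (inv g) N) = N"
proof -
  have "g \<circ> inv g = id" "inv g \<circ> g = id"
    using bij_is_surj[OF assms] bij_is_inj[OF assms] by (simp_all add: surj_iff inj_iff)
  then show "logic_action (inv g) (logic_action g N) = N" "logic_action g (logic_action (inv g) N) = N"
    by (auto simp: logic_action_def image_comp intro!: relstruct.equality)
qed

text \<open>Turns invariance under the logic action into exchangeability of the independent
  samples.\<close>

lemma logic_action_sample_structure:
  assumes "bij g"
  shows "logic_action g (sample_structure L ar M m p w) = sample_structure L ar M m p (w \<circ> inv g)"
proof (rule relstruct.equality)
  show "rel (logic_action g (sample_structure L ar M m p w)) =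
      rel (sample_structure L ar M m p (w \<circ> inv g))"
    by (intro ext set_eqI) (simp add: mem_rel_logic_action[OF assms], simp add: sample_structure_def o_def)
qed (use assms in \<open>auto simp: logic_action_def sample_structure_def bij_is_surj\<close>)

lemma distr_samples_permute:
  assumes "bij g"
  shows "distr samples samples (\<lambda>w. w \<circ> g) = samples"
  using distr_PiM_reindex[of UNIV "\<lambda>_. tosses" g UNIV] assms tosses.prob_space_axioms
  by (simp add: samples_def[symmetric] bij_is_inj o_def restrict_UNIV)

lemma invariant_sample_structure:
  "invariant_measure (distr samples (structure_space L ar) (sample_structure L ar M m p))"
  unfolding invariant_measure_def
proof (intro allI impI ballI)
  let ?T = "structure_space L ar" and ?\<Phi> = "sample_structure L ar M m p"
  let ?\<mu> = "distr samples ?T ?\<Phi>"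
  fix g :: "nat \<Rightarrow> nat" and A assume g: "bij g" and "A \<in> sets ?\<mu>"
  then have A: "A \<in> sets ?T" by simp
  note [measurable] = measurable_sample_structure
  have meas_perm: "(\<lambda>w. w \<circ> g) \<in> samples \<rightarrow>\<^sub>M samples"
    unfolding samples_def comp_def by (rule measurable_PiM_single') (auto simp: space_PiM)
  have "A \<subseteq> nat_structures L ar"
    using sets.sets_into_space[OF A] by (simp add: space_structure_space)
  then have image: "logic_action g ` A = logic_action (inv g) -` A \<inter> space ?T"
    using g logic_action_in_nat_structures[OF g]
    by (auto simp: space_structure_space logic_action_inv subset_eq image_iff)
      (metis logic_action_inv(2))
  have gA: "logic_action g ` A \<in> sets ?T"
    unfolding image by (intro measurable_sets[OF measurable_logic_action A] bij_imp_bij_inv g)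
  \<comment> \<open>Acting by \<open>inv g\<close> on the random structure reindexes its samples by
    \<open>g\<close>.\<close>
  have "?\<Phi> w \<in> logic_action g ` A \<longleftrightarrow> ?\<Phi> (w \<circ> g) \<in> A" for w
    using logic_action_sample_structure[OF bij_imp_bij_inv[OF g], of L ar M m p w] g
    by (simp add: image space_structure_space sample_structure_in inv_inv_eq)
  then have "emeasure ?\<mu> (logic_action g ` A) = emeasure samples ((\<lambda>w. w \<circ> g) -` (?\<Phi> -` A))"
    using gA by (subst emeasure_distr) (auto simp: vimage_def)
  also have "\<dots> = emeasure (distr samples samples (\<lambda>w. w \<circ> g)) (?\<Phi> -` A)"
    using measurable_sets[OF measurable_sample_structure A] meas_perm
    by (subst emeasure_distr) auto
  also have "\<dots> = emeasure ?\<mu> A"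
    using A by (subst (2) emeasure_distr) (auto simp: distr_samples_permute[OF g])
  finally show "emeasure ?\<mu> (logic_action g ` A) = emeasure ?\<mu> A" .
qed

theorem theorem3p20:
  fixes L :: "'r set" and ar :: "'r \<Rightarrow> nat" and M :: "('r, 'a) relstruct"
  assumes "countable L"
    and "is_structure L ar M"
    and "countable (universe M)"
    and "infinite (universe M)"
    and "trivial_dcl L ar M"
  shows "\<exists>\<mu>. sets \<mu> = sets (structure_space L ar) \<and> prob_space \<mu> \<and>
           invariant_measure \<mu> \<and> concentrated_on L ar \<mu> M"
proof -
  define f where "f = to_nat_on (universe M)"
  have f: "bij_betw f (universe M) UNIV"
    unfolding f_def using assms(3,4) by (rule to_nat_on_infinite)
  define M' :: "('r, nat) relstruct" where "M' = \<lparr>universe = UNIV, rel = (\<lambda>R. map f ` rel M R)\<rparr>"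
  have rel_subset: "rel M R \<subseteq> {xs. length xs = ar R \<and> set xs \<subseteq> universe M}" if "R \<in> L" for R
    using assms(2) that by (simp add: is_structure_def)
  have M': "M' \<in> nat_structures L ar"
    using assms(2) rel_subset by (fastforce simp: M'_def nat_structures_def is_structure_def)
  have iso_f: "iso_between L ar M M' f"
  proof -
    have "xs \<in> rel M R \<longleftrightarrow> map f xs \<in> map f ` rel M R"
      if "R \<in> L" "set xs \<subseteq> universe M" for R xs
    proof -
      have "xs = ys" if "map f xs = map f ys" "ys \<in> rel M R" for ys
      proof (rule map_inj_on[OF that(1)])
        have "set xs \<union> set ys \<subseteq> universe M"
          using that(2) rel_subset[OF \<open>R \<in> L\<close>] \<open>set xs \<subseteq> universe M\<close> by auto
        then show "inj_on f (set xs \<union> set ys)"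
          using f by (auto simp: bij_betw_def intro: inj_on_subset)
      qed
      then show ?thesis by auto
    qed
    with f show ?thesis
      by (simp add: iso_between_def M'_def)
  qed
  define G where "G = {g. automorphism L ar M' g}"
  have univ: "universe M' = UNIV"
    by (simp add: M'_def)
  have G_aut: "map g xs \<in> rel M' R \<longleftrightarrow> xs \<in> rel M' R" if "g \<in> G" "R \<in> L" for g R xs
  proof (cases "length xs = ar R")
    case True
    from that(1) have "\<forall>R\<in>L. \<forall>xs. length xs = ar R \<and> set xs \<subseteq> UNIV \<longrightarrow>
        (xs \<in> rel M' R \<longleftrightarrow> map g xs \<in> rel M' R)"
      unfolding G_def automorphism_def iso_between_def univ by blast
    with that(2) True show ?thesis by blast
  next
    case False
    moreover have "rel M' R \<subseteq> {xs. length xs = ar R}"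
      using M' that(2) by (auto simp: nat_structures_def is_structure_def)
    ultimately show ?thesis by auto
  qed
  interpret trivial_dcl_group G
  proof
    show "bij g" if "g \<in> G" for g
      using that unfolding G_def automorphism_def iso_between_def univ by blast
    show "id \<in> G"
      by (simp add: G_def automorphism_def iso_between_def univ)
    show "g \<circ> h \<in> G" if "g \<in> G" "h \<in> G" for g h
      using that by (simp add: G_def automorphism_def iso_between_comp)
    show "inv g \<in> G" if "g \<in> G" for g
      using that iso_between_inv_into[of L ar M' M' g] by (simp add: G_def automorphism_def univ)
    fix A :: "nat set" and b assume A: "finite A" "b \<notin> A"
    let ?h = "inv_into (universe M) f"
    have fh: "f (?h x) = x" and h_in: "?h x \<in> universe M" for x
      using f by (auto simp: bij_betw_inv_into_right bij_betw_def inv_into_into)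
    obtain as where as: "set as = ?h ` A"
      using finite_list[of "?h ` A"] A(1) by auto
    \<comment> \<open>Trivial definable closure of \<open>M\<close> is applied to the preimages of
      \<open>A\<close> and \<open>b\<close> under \<open>f\<close>.\<close>
    have "?h b \<notin> dcl L ar M as"
    proof -
      have "set as \<subseteq> universe M"
        using as h_in by auto
      then have "dcl L ar M as = ?h ` A"
        using assms(5) as by (simp add: trivial_dcl_def)
      moreover have "?h b \<notin> ?h ` A"
        using A(2) fh by (metis imageE)
      ultimately show ?thesis by simp
    qed
    then obtain k where k: "automorphism L ar M k" "\<And>a. a \<in> A \<Longrightarrow> k (?h a) = ?h a" "k (?h b) \<noteq> ?h b"
      using h_in as by (auto simp: dcl_def)
    \<comment> \<open>Conjugation by \<open>f\<close> turns automorphisms of \<open>M\<close> into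
      elements of \<open>G\<close>.\<close>
    have "f \<circ> k \<circ> ?h \<in> G"
      using iso_between_comp[OF iso_between_inv_into[OF iso_f] iso_between_comp[OF _ iso_f]] k(1)
      by (simp add: G_def automorphism_def)
    moreover have "(f \<circ> k \<circ> ?h) b \<noteq> b"
    proof
      assume "(f \<circ> k \<circ> ?h) b = b"
      then have "f (k (?h b)) = f (?h b)"
        by (simp add: fh)
      moreover have "k (?h b) \<in> universe M"
        using k(1) h_in by (auto simp: automorphism_def iso_between_def bij_betw_def)
      ultimately show False
        using f h_in k(3) by (auto simp: bij_betw_def dest: inj_onD)
    qed
    ultimately show "\<exists>g\<in>G. (\<forall>a\<in>A. g a = a) \<and> g b \<noteq> b"
      using k(2) fh by (intro bexI[of _ "f \<circ> k \<circ> ?h"]) auto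
  qed
  obtain m p where "inj_on m {1..}" "\<And>k. splitting m p k" "\<And>j n. \<exists>k\<ge>n. p k = j"
    "\<And>as b n. \<exists>n1\<ge>n. \<exists>n2. extension_at n1 n2 m p as b"
    by (rule ex_splitting_sequence) blast
  then interpret splitting_sequence G m p
    by unfold_locales
  let ?\<mu> = "distr samples (structure_space L ar) (sample_structure L ar M' m p)"
  interpret \<mu>: prob_space ?\<mu>
    by (rule samples.prob_space_distr[OF measurable_sample_structure])
  let ?C = "{N \<in> nat_structures L ar. isomorphic L ar M N}"
  \<comment> \<open>\<open>M\<close> and its copy \<open>M'\<close> are isomorphic to the same
    structures, so Scott's theorem for \<open>M'\<close> gives the measurability for
    \<open>M\<close>.\<close>
  have iso_iff: "isomorphic L ar M N \<longleftrightarrow> isomorphic L ar M' N" for N :: "('r, nat) relstruct"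
    unfolding isomorphic_def using iso_between_comp iso_f iso_between_inv_into[OF iso_f] by metis
  have C: "?C \<in> sets (structure_space L ar)"
    unfolding iso_iff by (rule isomorphism_class_measurable[OF assms(1) M'])
  have "AE w in samples. sample_structure L ar M' m p w \<in> ?C"
    using AE_generic_sample
  proof eventually_elim
    case (elim w)
    then interpret generic_sample G m p w .
    show ?case
      using sample_structure_isomorphic[OF M' G_aut] by (simp add: sample_structure_in iso_iff)
  qed
  then have "AE N in ?\<mu>. N \<in> ?C"
    using C by (subst AE_distr_iff[OF measurable_sample_structure]) (auto simp: space_structure_space)
  then have "emeasure ?\<mu> ?C = 1"
    using C by (intro \<mu>.emeasure_eq_1_AE) auto
  then show ?thesis
    using \<mu>.prob_space_axioms invariant_sample_structure
    by (intro exI[of _ ?\<mu>]) (auto simp: concentrated_on_def)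
qed

end
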